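(* Let $s\geq3$ be an odd integer and let $\left(\left(\tfrac{s-1}{2}\right)^3,\mu_4,\ldots,\mu_r\right)$ be a sub-homaloidal multiplicity set in degree $s$ such that $(2s-1;(s-1)^3,2\mu_4,\ldots,2\mu_r)$ is a proper homaloidal type. Let $I\subset R=k[x,y,z]$ be the base ideal of a Cremona map $\mathfrak{F}$ on $r$ general points having this homaloidal type. Let $f_1,f_2,f_3\in R$ be defining forms of three principal curves of $\mathfrak{F}$ of degree $s-1$ and let $\ell_1,\ell_2,\ell_3\in R$ be linearly independent linear forms such that $$I=(\ell_1f_1f_2,\ \ell_2f_2f_3,\ \ell_3f_1f_3).$$ Then: (a) $I$ is a non-saturated ideal with minimal graded resolution $$0\to R(-3s)\stackrel{\psi}{\longrightarrow}R(-(3s-1))^3\stackrel{\varphi}{\longrightarrow}R(-(2s-1))^3\to I\to 0,$$ where the basis of $R(-(2s-1))^3$ is sent to $\ell_1f_1f_2,\ \ell_2f_2f_3,\ \ell_3f_1f_3$ in this order, and $$\varphi=\begin{pmatrix}\ell_2f_3&-\ell_3f_3&0\\-\ell_1f_1&0&\ell_3f_1\\0&\ell_1f_2&-\ell_2f_2\end{pmatrix},\qquad \psi=\begin{pmatrix}\ell_3\\\ell_2\\\ell_1\end{pmatrix}.$$ (b) $I^{\rm sat}=(I,\,f_1f_2f_3)$.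
   Context: $k$ is an algebraically closed field and $R=k[x,y,z]$ has the standard grading. Exponents on multiplicities denote repetition. $I^{\rm sat}$ is the saturation of $I$ with respect to $(x,y,z)$. A set (with repetitions) of nonnegative integers $\{\mu_1,\ldots,\mu_r\}$ is a sub-homaloidal multiplicity set in degree $s$ if $\sum_i\mu_i=3(s-1)$ and $\sum_i\mu_i^2=s(s-1)$. A plane Cremona map of degree $d$ is a birational map $\mathbb{P}^2\dashrightarrow\mathbb{P}^2$ defined by three $k$-linearly independent forms of degree $d$ without common factor; the ideal $I$ they generate is its base ideal. A homaloidal type of degree $d$ is a tuple $(d;\nu_1,\ldots,\nu_r)$ with $\sum\nu_i=3d-3$, $\sum\nu_i^2=d^2-1$; the type of a Cremona map is given by its degree and its virtual multiplicities at all its base points (proper and infinitely near), where the virtual multiplicity at a point is the minimum of the multiplicities there of members of the defining linear system (after blowing up for infinitely near points). A homaloidal type is proper if it is the type of some plane Cremona map. "A Cremona map on $r$ general points" of a given type means one whose base points are proper points $p_1,\ldots,p_r\in\mathbb{P}^2$ with $(p_1,\ldots,p_r)$ in a suitable non-empty Zariski open subset of $(\mathbb{P}^2)^r$, the multiplicities being attached to the points in order. A principal curve of $\mathfrak{F}$ is an irreducible plane curve contracted by $\mathfrak{F}$ to a point (a base point of $\mathfrak{F}^{-1}$). In the situation considered, such forms $f_i$ and $\ell_i$ exist. *)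

theory Defs
  imports
    "HOL-Analysis.Analysis"
    "HOL-Library.Poly_Mapping"
begin

text \<open>Polynomials over \<open>'k\<close> in variables indexed by \<open>'v\<close>, as the monoid algebra of the monoid
  of exponent vectors. The ring \<open>k[x,y,z]\<close> is \<open>(3, 'k) mpoly\<close>, with variables \<open>x, y, z\<close>
  indexed by the elements \<open>1, 2, 3\<close> of the type \<open>3\<close>.\<close>

type_synonym ('v, 'k) mpoly = "('v \<Rightarrow>\<^sub>0 nat) \<Rightarrow>\<^sub>0 'k"

definition mconst :: "'k::comm_ring_1 \<Rightarrow> ('v, 'k) mpoly" where
  "mconst c = Poly_Mapping.single 0 c"

definition mvar :: "'v \<Rightarrow> ('v, 'k::comm_ring_1) mpoly" where
  "mvar v = Poly_Mapping.single (Poly_Mapping.single v 1) 1"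

definition mdeg :: "('v \<Rightarrow>\<^sub>0 nat) \<Rightarrow> nat" where
  "mdeg m = (\<Sum>v\<in>Poly_Mapping.keys m. Poly_Mapping.lookup m v)"

definition mpoly_lift :: "('k::comm_ring_1 \<Rightarrow> 'b::comm_ring_1) \<Rightarrow> ('v \<Rightarrow> 'b) \<Rightarrow> ('v, 'k) mpoly \<Rightarrow> 'b" where
  "mpoly_lift h g f = (\<Sum>m\<in>Poly_Mapping.keys f. h (Poly_Mapping.lookup f m) * (\<Prod>v\<in>Poly_Mapping.keys m. g v ^ Poly_Mapping.lookup m v))"

definition mpoly_eval :: "('v \<Rightarrow> 'k) \<Rightarrow> ('v, 'k::comm_ring_1) mpoly \<Rightarrow> 'k" where
  "mpoly_eval g f = mpoly_lift id g f"

definition mpoly_subst :: "('v \<Rightarrow> ('w, 'k) mpoly) \<Rightarrow> ('v, 'k::comm_ring_1) mpoly \<Rightarrow> ('w, 'k) mpoly" where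
  "mpoly_subst g f = mpoly_lift mconst g f"

definition homogeneous :: "nat \<Rightarrow> ('v, 'k::comm_ring_1) mpoly \<Rightarrow> bool" where
  "homogeneous d f \<longleftrightarrow> (\<forall>m\<in>Poly_Mapping.keys f. mdeg m = d)"

definition forms_independent :: "('v, 'k::field) mpoly ^ 3 \<Rightarrow> bool" where
  "forms_independent F \<longleftrightarrow> (\<forall>c :: 'k ^ 3. (\<Sum>i\<in>UNIV. mconst (c $ i) * F $ i) = 0 \<longrightarrow> c = 0)"

definition no_common_factor :: "('v, 'k::field) mpoly ^ 3 \<Rightarrow> bool" where
  "no_common_factor F \<longleftrightarrow> (\<forall>h. (\<forall>i. h dvd F $ i) \<longrightarrow> h dvd 1)"

definition ideal_gen :: "'r::comm_ring_1 set \<Rightarrow> 'r set" where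
  "ideal_gen S = module.span (*) S"

definition max_ideal :: "(3, 'k::field) mpoly set" where
  "max_ideal = ideal_gen (range mvar)"

primrec ideal_power :: "'r::comm_ring_1 set \<Rightarrow> nat \<Rightarrow> 'r set" where
  "ideal_power J 0 = UNIV"
| "ideal_power J (Suc n) = ideal_gen {a * b | a b. a \<in> J \<and> b \<in> ideal_power J n}"

definition saturation :: "(3, 'k::field) mpoly set \<Rightarrow> (3, 'k) mpoly set" where
  "saturation I = {g. \<exists>n. \<forall>h\<in>ideal_power max_ideal n. h * g \<in> I}"

text \<open>A tuple \<open>a :: 'm \<Rightarrow> nat\<close> stands for the graded free module \<open>\<Oplus>\<^sub>i R(-a\<^sub>i)\<close>.
  The following says that \<open>A\<close> is a degree-preserving map
  \<open>\<Oplus>\<^sub>j R(-b\<^sub>j) \<rightarrow> \<Oplus>\<^sub>i R(-a\<^sub>i)\<close>.\<close>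

definition graded_matrix ::
  "('m \<Rightarrow> nat) \<Rightarrow> ('n \<Rightarrow> nat) \<Rightarrow> (3, 'k::field) mpoly ^ 'n ^ 'm \<Rightarrow> bool" where
  "graded_matrix a b A \<longleftrightarrow>
     (\<forall>i j. A $ i $ j = 0 \<or> (\<exists>d. d + a i = b j \<and> homogeneous d (A $ i $ j)))"

text \<open>The complex
  \<open>0 \<rightarrow> \<Oplus>\<^sub>l R(-c\<^sub>l) \<rightarrow> \<Oplus>\<^sub>j R(-b\<^sub>j) \<rightarrow> \<Oplus>\<^sub>i R(-a\<^sub>i) \<rightarrow> I \<rightarrow> 0\<close>
  with maps \<open>\<psi>\<close>, \<open>\<phi>\<close> and \<open>e\<^sub>i \<mapsto> g\<^sub>i\<close> is graded, exact and minimal.\<close>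

definition minimal_graded_resolution ::
  "(3, 'k::field) mpoly set \<Rightarrow> ('m::finite \<Rightarrow> nat) \<Rightarrow> ('n::finite \<Rightarrow> nat) \<Rightarrow> ('p::finite \<Rightarrow> nat) \<Rightarrow>
   (3, 'k) mpoly ^ 'm \<Rightarrow> (3, 'k) mpoly ^ 'n ^ 'm \<Rightarrow> (3, 'k) mpoly ^ 'p ^ 'n \<Rightarrow> bool" where
  "minimal_graded_resolution I a b c g \<phi> \<psi> \<longleftrightarrow>
     (\<forall>i. homogeneous (a i) (g $ i)) \<and> graded_matrix a b \<phi> \<and> graded_matrix b c \<psi> \<and>
     range (\<lambda>v. \<Sum>i\<in>UNIV. v $ i * g $ i) = I \<and>
     {v. (\<Sum>i\<in>UNIV. v $ i * g $ i) = 0} = range ((*v) \<phi>) \<and>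
     {w. \<phi> *v w = 0} = range ((*v) \<psi>) \<and>
     inj ((*v) \<psi>) \<and>
     (\<forall>i j. \<phi> $ i $ j \<in> max_ideal) \<and> (\<forall>j l. \<psi> $ j $ l \<in> max_ideal)"

definition proj_rel :: "'k::field ^ 3 \<Rightarrow> 'k ^ 3 \<Rightarrow> bool" where
  "proj_rel v w \<longleftrightarrow> v \<noteq> 0 \<and> w \<noteq> 0 \<and> (\<exists>c. w = c *s v)"

lemma part_equivp_proj_rel: "part_equivp (proj_rel :: 'k::field ^ 3 \<Rightarrow> _)"
proof (rule part_equivpI)
  have "axis 1 1 \<noteq> (0 :: 'k ^ 3)"
    by (metis axis_nth zero_index zero_neq_one)
  then have "proj_rel (axis 1 1 :: 'k ^ 3) (axis 1 1)"
    unfolding proj_rel_def by (metis vector_smult_lid)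
  then show "\<exists>x :: 'k ^ 3. proj_rel x x" ..
  show "symp (proj_rel :: 'k ^ 3 \<Rightarrow> _)"
  proof (rule sympI)
    fix v w :: "'k ^ 3"
    assume "proj_rel v w"
    then obtain c where c: "v \<noteq> 0" "w \<noteq> 0" "w = c *s v"
      unfolding proj_rel_def by blast
    then have "c \<noteq> 0" by auto
    then have "v = inverse c *s w"
      using c(3) by (simp add: vector_smult_assoc)
    then show "proj_rel w v" using c unfolding proj_rel_def by blast
  qed
  show "transp (proj_rel :: 'k ^ 3 \<Rightarrow> _)"
    by (rule transpI) (auto simp: proj_rel_def vector_smult_assoc)
qed

quotient_type (overloaded) 'k proj_plane = "('k::field) ^ 3" / partial: proj_rel
  by (rule part_equivp_proj_rel)

definition vanishes_at :: "(3, 'k::field) mpoly \<Rightarrow> 'k proj_plane \<Rightarrow> bool" where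
  "vanishes_at f P \<longleftrightarrow> mpoly_eval (($) (rep_proj_plane P)) f = 0"

text \<open>Multihomogeneous polynomials in the homogeneous coordinates of \<open>r\<close> points: the variable
  \<open>(i, j)\<close> is the \<open>j\<close>-th coordinate of the \<open>i\<close>-th point, \<open>i < r\<close>.\<close>

definition multihomogeneous :: "nat \<Rightarrow> (nat \<times> 3, 'k::field) mpoly \<Rightarrow> bool" where
  "multihomogeneous r g \<longleftrightarrow>
     (\<exists>e. \<forall>m\<in>Poly_Mapping.keys g. (\<forall>i<r. (\<Sum>j\<in>UNIV. Poly_Mapping.lookup m (i, j)) = e i) \<and> (\<forall>i\<ge>r. \<forall>j. Poly_Mapping.lookup m (i, j) = 0))"

definition zariski_open :: "nat \<Rightarrow> ('k::field) proj_plane list set \<Rightarrow> bool" where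
  "zariski_open r U \<longleftrightarrow>
     (\<exists>S. (\<forall>g\<in>S. multihomogeneous r g) \<and>
          U = {ps. length ps = r \<and>
                   (\<exists>g\<in>S. mpoly_eval (\<lambda>(i, j). rep_proj_plane (ps ! i) $ j) g \<noteq> 0)})"

text \<open>\<open>G\<close> represents, in lowest terms, the rational map inverse to the one given by \<open>F\<close>.\<close>

definition rational_inverse :: "(3, 'k::field) mpoly ^ 3 \<Rightarrow> (3, 'k) mpoly ^ 3 \<Rightarrow> bool" where
  "rational_inverse F G \<longleftrightarrow>
     (\<exists>e. \<forall>i. homogeneous e (G $ i)) \<and> no_common_factor G \<and>
     (\<exists>H. H \<noteq> 0 \<and> (\<forall>i. mpoly_subst (($) F) (G $ i) = H * mvar i)) \<and>
     (\<exists>H. H \<noteq> 0 \<and> (\<forall>i. mpoly_subst (($) G) (F $ i) = H * mvar i))"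

definition cremona_map :: "nat \<Rightarrow> (3, 'k::field) mpoly ^ 3 \<Rightarrow> bool" where
  "cremona_map d F \<longleftrightarrow>
     (\<forall>i. homogeneous d (F $ i)) \<and> forms_independent F \<and> no_common_factor F \<and>
     (\<exists>G. rational_inverse F G)"

definition base_ideal :: "(3, 'k::field) mpoly ^ 3 \<Rightarrow> (3, 'k) mpoly set" where
  "base_ideal F = ideal_gen (range (($) F))"

definition linear_system :: "(3, 'k::field) mpoly ^ 3 \<Rightarrow> (3, 'k) mpoly set" where
  "linear_system F = {\<Sum>i\<in>UNIV. mconst (c $ i) * F $ i | c :: 'k ^ 3. True}"

text \<open>Affine coordinates \<open>u = mvar 1\<close>, \<open>v = mvar 2\<close> centred at the point \<open>P\<close>: a coordinate \<open>i\<close>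
  in which \<open>P\<close> does not vanish is kept fixed and \<open>u\<close>, \<open>v\<close> are added to the two others
  (\<open>i\<close>, \<open>i + 1\<close>, \<open>i + 2\<close> are the three elements of the type \<open>3\<close>).\<close>

definition chart :: "'k::field proj_plane \<Rightarrow> (2, 'k) mpoly ^ 3" where
  "chart P =
     (let p = rep_proj_plane P; i = (SOME i. p $ i \<noteq> 0)
      in \<chi> j. mconst (p $ j) + (if j = i + 1 then mvar 1 else if j = i + 2 then mvar 2 else 0))"

definition local_system :: "(3, 'k::field) mpoly ^ 3 \<Rightarrow> 'k proj_plane \<Rightarrow> (2, 'k) mpoly set" where
  "local_system F P = mpoly_subst (($) (chart P)) ` linear_system F"

text \<open>Multiplicity at the origin, for \<open>f \<noteq> 0\<close>.\<close>

definition origin_mult :: "(2, 'k::field) mpoly \<Rightarrow> nat" where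
  "origin_mult f = Min (mdeg ` Poly_Mapping.keys f)"

definition system_mult :: "(2, 'k::field) mpoly set \<Rightarrow> nat" where
  "system_mult L = Inf (origin_mult ` (L - {0}))"

text \<open>The points of the exceptional line of the blow-up of the origin are the tangent directions
  there: \<open>Some a\<close> is the direction \<open>v = a u\<close>, and \<open>None\<close> is the direction \<open>u = 0\<close>. Around such a
  point the blow-up is \<open>(u, v) \<mapsto> (u, u (v + a))\<close>, respectively \<open>(u, v) \<mapsto> (u v, v)\<close>, in
  coordinates centred at the point, and the exceptional line is \<open>u = 0\<close>, respectively \<open>v = 0\<close>.\<close>

definition blowup_chart :: "'k::field option \<Rightarrow> (2, 'k) mpoly ^ 2" where
  "blowup_chart t =
     (case t of Some a \<Rightarrow> vector [mvar 1, mvar 1 * (mvar 2 + mconst a)]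
              | None \<Rightarrow> vector [mvar 1 * mvar 2, mvar 2])"

definition exceptional_eq :: "'k::field option \<Rightarrow> (2, 'k) mpoly" where
  "exceptional_eq t = (case t of Some a \<Rightarrow> mvar 1 | None \<Rightarrow> mvar 2)"

definition virtual_transform :: "'k::field option \<Rightarrow> (2, 'k) mpoly set \<Rightarrow> (2, 'k) mpoly set" where
  "virtual_transform t L =
     {g. \<exists>f\<in>L. mpoly_subst (($) (blowup_chart t)) f = exceptional_eq t ^ system_mult L * g}"

text \<open>A point of the plane or infinitely near to it is a pair \<open>(P, ts)\<close>: starting from the proper
  point \<open>P\<close>, blow up successively and follow the directions in \<open>ts\<close>. Proper points are those with
  \<open>ts = []\<close>, and distinct pairs are distinct points.\<close>

definition virtual_mult ::
  "(3, 'k::field) mpoly ^ 3 \<Rightarrow> 'k proj_plane \<times> 'k option list \<Rightarrow> nat" where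
  "virtual_mult F x = system_mult (fold virtual_transform (snd x) (local_system F (fst x)))"

definition base_points :: "(3, 'k::field) mpoly ^ 3 \<Rightarrow> ('k proj_plane \<times> 'k option list) set" where
  "base_points F = {x. virtual_mult F x > 0}"

definition homaloidal_type :: "nat \<Rightarrow> nat list \<Rightarrow> bool" where
  "homaloidal_type d \<nu> \<longleftrightarrow>
     int (\<Sum>n\<leftarrow>\<nu>. n) = 3 * int d - 3 \<and> int (\<Sum>n\<leftarrow>\<nu>. n ^ 2) = int d ^ 2 - 1"

definition sub_homaloidal :: "nat \<Rightarrow> nat list \<Rightarrow> bool" where
  "sub_homaloidal s \<mu> \<longleftrightarrow>
     int (\<Sum>n\<leftarrow>\<mu>. n) = 3 * (int s - 1) \<and> int (\<Sum>n\<leftarrow>\<mu>. n ^ 2) = int s * (int s - 1)"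

text \<open>Zero entries of a type carry no base point, so they are discarded in the comparison.
  The first argument only names the ground field.\<close>

definition proper_homaloidal_type :: "'k::field itself \<Rightarrow> nat \<Rightarrow> nat list \<Rightarrow> bool" where
  "proper_homaloidal_type _ d \<nu> \<longleftrightarrow>
     homaloidal_type d \<nu> \<and>
     (\<exists>F :: (3, 'k) mpoly ^ 3. cremona_map d F \<and> finite (base_points F) \<and>
        image_mset (virtual_mult F) (mset_set (base_points F)) = filter_mset (\<lambda>n. n > 0) (mset \<nu>))"

definition cremona_map_on_points ::
  "nat \<Rightarrow> nat list \<Rightarrow> 'k::field proj_plane list \<Rightarrow> (3, 'k) mpoly ^ 3 \<Rightarrow> bool" where
  "cremona_map_on_points d \<nu> ps F \<longleftrightarrow>
     cremona_map d F \<and> homaloidal_type d \<nu> \<and> length ps = length \<nu> \<and> distinct ps \<and>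
     (\<forall>i<length ps. virtual_mult F (ps ! i, []) = \<nu> ! i) \<and>
     base_points F \<subseteq> {(P, []) | P. P \<in> set ps}"

definition map_point :: "(3, 'k::field) mpoly ^ 3 \<Rightarrow> 'k proj_plane \<Rightarrow> 'k proj_plane" where
  "map_point F P = abs_proj_plane (\<chi> i. mpoly_eval (($) (rep_proj_plane P)) (F $ i))"

text \<open>\<open>f\<close> defines an irreducible curve of degree \<open>d\<close> which \<open>F\<close> contracts (where it is defined) to a
  point \<open>Q\<close>, a base point of the inverse of \<open>F\<close>.\<close>

definition principal_curve :: "(3, 'k::field) mpoly ^ 3 \<Rightarrow> nat \<Rightarrow> (3, 'k) mpoly \<Rightarrow> bool" where
  "principal_curve F d f \<longleftrightarrow>
     homogeneous d f \<and> irreducible f \<and>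
     (\<exists>Q. (\<forall>P. vanishes_at f P \<and> (\<exists>i. \<not> vanishes_at (F $ i) P) \<longrightarrow> map_point F P = Q) \<and>
          (\<exists>G. rational_inverse F G \<and> (\<forall>i. vanishes_at (G $ i) Q)))"

end

theory Submission
  imports Defs "Berlekamp_Zassenhaus.Unique_Factorization_Poly"
begin

text \<open>Since \<open>k[x,y,z]\<close> is factorial, the \<open>f\<^sub>i\<close> are prime, and none of them divides a nonzero linear form.
  Hence in a syzygy of \<open>l\<^sub>1f\<^sub>1f\<^sub>2, l\<^sub>2f\<^sub>2f\<^sub>3, l\<^sub>3f\<^sub>1f\<^sub>3\<close> the coefficients are divisible by
  \<open>f\<^sub>3, f\<^sub>1, f\<^sub>2\<close>, and cancelling leaves a syzygy of \<open>l\<^sub>1, l\<^sub>2, l\<^sub>3\<close>, which is a Koszul syzygy. Together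
  with \<open>f\<^sub>1f\<^sub>2f\<^sub>3\<close> the three generators are the maximal minors of a 4 by 3 matrix and generate
  a perfect, hence saturated, ideal; multiplying \<open>f\<^sub>1f\<^sub>2f\<^sub>3\<close> by any \<open>l\<^sub>i\<close> gives a multiple of a generator.\<close>

no_notation Matrix.vec_index (infixl "$" 100)

section \<open>Unique factorization in \<open>k[x,y,z]\<close>\<close>

definition free_of :: "'v \<Rightarrow> ('v, 'k::comm_ring_1) mpoly set" where
  "free_of v = {f. \<forall>m\<in>Poly_Mapping.keys f. Poly_Mapping.lookup m v = 0}"

lemma free_of_add: "f \<in> free_of v \<Longrightarrow> g \<in> free_of v \<Longrightarrow> f + g \<in> free_of v"
  unfolding free_of_def by (auto dest!: subsetD[OF Poly_Mapping.keys_add])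

lemma free_of_zero: "0 \<in> free_of v"
  by (simp add: free_of_def)

lemma free_of_uminus: "f \<in> free_of v \<Longrightarrow> - f \<in> free_of v"
  by (simp add: free_of_def)

lemma free_of_mult: "f \<in> free_of v \<Longrightarrow> g \<in> free_of v \<Longrightarrow> f * g \<in> free_of v"
  unfolding free_of_def
  by (auto dest!: subsetD[OF Poly_Mapping.keys_mult] simp: Poly_Mapping.lookup_add)

lemma free_of_mconst: "mconst c \<in> free_of v"
  by (simp add: free_of_def mconst_def)

lemma free_of_mvar: "v \<noteq> w \<Longrightarrow> mvar w \<in> free_of v"
  by (simp add: free_of_def mvar_def lookup_single_not_eq)

text \<open>Every monomial of \<open>mvar v * q\<close> contains \<open>v\<close>, so the product
  has no monomials at all. The linear order on the variables orders the exponent vectors, which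
  makes the polynomial ring a domain.\<close>

lemma mvar_mult_free_ofD:
  fixes q :: "('v::linorder, 'k::field) mpoly"
  assumes "mvar v * q \<in> free_of v"
  shows "q = 0"
proof -
  have "Poly_Mapping.lookup m v \<noteq> 0" if "m \<in> Poly_Mapping.keys (mvar v * q)" for m
    using that Poly_Mapping.keys_mult[of "mvar v" q]
    by (auto simp: mvar_def Poly_Mapping.lookup_add)
  with assms have "Poly_Mapping.keys (mvar v * q) = {}"
    unfolding free_of_def by blast
  then have "mvar v * q = 0" by simp
  moreover have "mvar v \<noteq> (0 :: ('v, 'k) mpoly)"
    by (metis mvar_def keys_zero keys_single insert_not_empty zero_neq_one)
  ultimately show ?thesis by simp
qed

section \<open>Induction over monomials and over ring generators\<close>

lemma mpoly_induct [case_names monom add]: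
  assumes monom: "\<And>m c. P (Poly_Mapping.single m c)"
    and add: "\<And>f g. P f \<Longrightarrow> P g \<Longrightarrow> P (f + g)"
  shows "P (f :: ('v, 'k::comm_ring_1) mpoly)"
proof (induction f rule: update_induct)
  case const
  show ?case using monom[of 0 0] by simp
next
  case (update f a b)
  have "Poly_Mapping.update a b f = f + Poly_Mapping.single a b"
    using update(1)
    by (intro poly_mapping_eqI)
      (auto simp: lookup_update Poly_Mapping.lookup_add lookup_single when_def in_keys_iff)
  then show ?case using update monom add by metis
qed

lemma mpoly_generate_induct [case_names mconst mvar add mult]:
  assumes mconst: "\<And>c. P (mconst c)" and mvar: "\<And>v. P (mvar v)"
    and add: "\<And>f g. P f \<Longrightarrow> P g \<Longrightarrow> P (f + g)"
    and mult: "\<And>f g. P f \<Longrightarrow> P g \<Longrightarrow> P (f * g)"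
  shows "P (f :: ('v, 'k::comm_ring_1) mpoly)"
proof (induction f rule: mpoly_induct)
  case (monom m c)
  have pw: "P (Poly_Mapping.single (Poly_Mapping.single v n) 1)" for v n
  proof (induction n)
    case 0
    then show ?case using mconst[of 1] by (simp add: mconst_def)
  next
    case (Suc n)
    have "Poly_Mapping.single (Poly_Mapping.single v (Suc n)) 1
        = (mvar v * Poly_Mapping.single (Poly_Mapping.single v n) 1 :: ('v, 'k) mpoly)"
      by (simp add: mvar_def mult_single flip: Poly_Mapping.single_add)
    then show ?case using mult mvar Suc by metis
  qed
  show ?case
  proof (induction m rule: update_induct)
    case const
    then show ?case using mconst[of c] by (simp add: mconst_def)
  next
    case (update m v n)
    have "Poly_Mapping.update v n m = Poly_Mapping.single v n + m"
      using update(1)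
      by (intro poly_mapping_eqI)
        (auto simp: lookup_update Poly_Mapping.lookup_add lookup_single when_def in_keys_iff)
    then have "Poly_Mapping.single (Poly_Mapping.update v n m) c
        = Poly_Mapping.single (Poly_Mapping.single v n) 1 * Poly_Mapping.single m c"
      by (simp add: mult_single)
    then show ?case using mult pw update by metis
  qed
qed (rule add)

section \<open>Adjoining a variable: evaluation of univariate polynomials at
  \<open>mvar v\<close>\<close>

lemma eval_poly_comm_ring_hom:
  assumes "comm_ring_hom h"
  shows "comm_ring_hom (\<lambda>p. eval_poly h p x)"
proof -
  interpret comm_ring_hom h by fact
  interpret map_hom: map_poly_comm_ring_hom h ..
  show ?thesis
    by unfold_locales (simp_all add: eval_poly_def hom_distribs)
qed

lemma eval_poly_pCons':
  assumes "comm_ring_hom h"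
  shows "eval_poly h (pCons a p) x = h a + x * eval_poly h p x"
proof -
  interpret comm_ring_hom h by fact
  interpret map_hom: map_poly_comm_ring_hom h ..
  show ?thesis
    by (simp add: eval_poly_def hom_distribs)
qed

lemma eval_poly_const_X:
  assumes "comm_ring_hom h"
  shows "eval_poly h [:c:] x = h c" "eval_poly h (pCons 0 1) x = x"
proof -
  interpret comm_ring_hom h by fact
  have "eval_poly h 0 x = 0" by (simp add: eval_poly_def)
  moreover have "eval_poly h 1 x = 1" by (simp add: eval_poly_def)
  ultimately show "eval_poly h [:c:] x = h c" "eval_poly h (pCons 0 1) x = x"
    by (simp_all add: eval_poly_pCons'[OF assms])
qed

text \<open>In Horner form the value of \<open>pCons a p\<close> is \<open>h a + mvar v * _\<close>.
  The first summand is free of \<open>v\<close> and every monomial of the second contains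
  \<open>v\<close>, so if the sum vanishes, both do.\<close>

lemma eval_poly_mvar_inj:
  fixes h :: "'a::comm_ring_1 \<Rightarrow> ('v::linorder, 'k::field) mpoly"
  assumes h: "comm_ring_hom h" and inj: "\<And>a. h a = 0 \<Longrightarrow> a = 0"
    and free: "\<And>a. h a \<in> free_of v"
  shows "eval_poly h p (mvar v) = 0 \<Longrightarrow> p = 0"
proof (induction p)
  case 0
  show ?case ..
next
  case (pCons a p)
  have *: "h a + mvar v * eval_poly h p (mvar v) = 0"
    using pCons.prems by (simp add: eval_poly_pCons'[OF h])
  then have "mvar v * eval_poly h p (mvar v) = - h a"
    by (simp add: eq_neg_iff_add_eq_0 add.commute)
  then have "eval_poly h p (mvar v) = 0"
    using free free_of_uminus mvar_mult_free_ofD by metis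
  then show ?case using pCons.IH * inj by auto
qed

lemma eval_poly_mvar_free_of:
  fixes h :: "'a::comm_ring_1 \<Rightarrow> ('v::linorder, 'k::field) mpoly"
  assumes h: "comm_ring_hom h" and free: "\<And>a. h a \<in> free_of w" and "w \<noteq> v"
  shows "eval_poly h p (mvar v) \<in> free_of w"
proof (induction p)
  case 0
  show ?case by (simp add: eval_poly_def free_of_zero)
next
  case (pCons a p)
  then show ?case
    using assms by (auto simp: eval_poly_pCons'[OF h] intro!: free_of_add free_of_mult free_of_mvar)
qed

lemma mconst_hom: "comm_ring_hom (mconst :: 'k::comm_ring_1 \<Rightarrow> ('v, 'k) mpoly)"
  by unfold_locales (simp_all add: mconst_def mult_single Poly_Mapping.single_add)

text \<open>Unique factorization is available for iterated univariate polynomials. The three maps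
  add one variable at a time and identify k[x][y][z] with R, so that it can be carried over.\<close>

definition mpoly_of_poly1 :: "'k::field poly \<Rightarrow> (3, 'k) mpoly" where
  "mpoly_of_poly1 p = eval_poly mconst p (mvar 1)"

definition mpoly_of_poly2 :: "'k::field poly poly \<Rightarrow> (3, 'k) mpoly" where
  "mpoly_of_poly2 p = eval_poly mpoly_of_poly1 p (mvar 2)"

definition mpoly_of_poly3 :: "'k::field poly poly poly \<Rightarrow> (3, 'k) mpoly" where
  "mpoly_of_poly3 p = eval_poly mpoly_of_poly2 p (mvar 3)"

lemma mpoly_of_poly1_hom: "comm_ring_hom mpoly_of_poly1"
  using eval_poly_comm_ring_hom[OF mconst_hom] by (simp add: mpoly_of_poly1_def[abs_def])

lemma mpoly_of_poly2_hom: "comm_ring_hom mpoly_of_poly2"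
  using eval_poly_comm_ring_hom[OF mpoly_of_poly1_hom] by (simp add: mpoly_of_poly2_def[abs_def])

lemma mpoly_of_poly3_hom: "comm_ring_hom mpoly_of_poly3"
  using eval_poly_comm_ring_hom[OF mpoly_of_poly2_hom] by (simp add: mpoly_of_poly3_def[abs_def])

text \<open>At each stage the coefficients involve only the variables adjoined earlier, so
  evaluation at the new variable is injective; the three stages are then composed.\<close>

lemma mpoly_of_poly3_inj: "mpoly_of_poly3 p = 0 \<Longrightarrow> p = 0"
proof -
  have d: "(1::3) \<noteq> 2" "(1::3) \<noteq> 3" "(2::3) \<noteq> 3" by simp_all
  have 0: "mconst c = (0 :: (3, 'a) mpoly) \<Longrightarrow> c = 0" for c
    by (metis mconst_def single_zero lookup_single_eq)
  have f1: "mpoly_of_poly1 p \<in> free_of 2" "mpoly_of_poly1 p \<in> free_of 3" for p :: "'a poly"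
    unfolding mpoly_of_poly1_def
    using eval_poly_mvar_free_of[OF mconst_hom free_of_mconst] d by metis+
  have f2: "mpoly_of_poly2 p \<in> free_of 3" for p :: "'a poly poly"
    unfolding mpoly_of_poly2_def
    using eval_poly_mvar_free_of[OF mpoly_of_poly1_hom f1(2)] d by metis
  have 1: "p = 0" if "mpoly_of_poly1 p = 0" for p :: "'a poly"
    using eval_poly_mvar_inj[OF mconst_hom 0 free_of_mconst] that
    unfolding mpoly_of_poly1_def by metis
  have 2: "p = 0" if "mpoly_of_poly2 p = 0" for p :: "'a poly poly"
    using eval_poly_mvar_inj[OF mpoly_of_poly1_hom 1 f1(1)] that
    unfolding mpoly_of_poly2_def by metis
  show "mpoly_of_poly3 p = 0 \<Longrightarrow> p = 0"
    using eval_poly_mvar_inj[OF mpoly_of_poly2_hom 2 f2]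
    unfolding mpoly_of_poly3_def by metis
qed

text \<open>The image is closed under sums and products and contains all constants and
  variables.\<close>

lemma mpoly_of_poly3_surj: "surj mpoly_of_poly3"
proof -
  interpret comm_ring_hom mpoly_of_poly3 by (rule mpoly_of_poly3_hom)
  note simps = eval_poly_const_X mpoly_of_poly1_def mpoly_of_poly2_def mpoly_of_poly3_def
    mconst_hom mpoly_of_poly1_hom mpoly_of_poly2_hom
  have c: "mpoly_of_poly3 [:[:[:c:]:]:] = mconst c" for c :: 'a
    by (simp add: simps)
  have v: "mpoly_of_poly3 [:[:[:0, 1:]:]:] = (mvar 1 :: (3, 'a) mpoly)"
    "mpoly_of_poly3 [:[:0, 1:]:] = (mvar 2 :: (3, 'a) mpoly)"
    "mpoly_of_poly3 [:0, 1:] = (mvar 3 :: (3, 'a) mpoly)"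
    by (simp_all add: simps)
  have "f \<in> range mpoly_of_poly3" for f :: "(3, 'a) mpoly"
  proof (induction f rule: mpoly_generate_induct)
    case (mconst c)
    then show ?case using c by (metis rangeI)
  next
    case (mvar v)
    then show ?case
      using v exhaust_3[of v]
      by (metis rangeI)
  next
    case (add f g)
    then obtain p q where "f = mpoly_of_poly3 p" "g = mpoly_of_poly3 q" by blast
    then show ?case by (intro range_eqI[of _ _ "p + q"]) (simp add: hom_add)
  next
    case (mult f g)
    then obtain p q where "f = mpoly_of_poly3 p" "g = mpoly_of_poly3 q" by blast
    then show ?case by (intro range_eqI[of _ _ "p * q"]) (simp add: hom_mult)
  qed
  then show ?thesis by blast
qed

lemma irreducible_imp_prime_elem_mpoly:
  fixes f :: "(3, 'k::field) mpoly"
  assumes "irreducible f"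
  shows "prime_elem f"
proof -
  interpret comm_ring_hom mpoly_of_poly3 by (rule mpoly_of_poly3_hom)
  interpret inj: inj_comm_ring_hom mpoly_of_poly3
    by unfold_locales (rule mpoly_of_poly3_inj)
  have surj: "\<exists>p. g = mpoly_of_poly3 p" for g :: "(3, 'k) mpoly"
    using mpoly_of_poly3_surj by (metis surjD)
  have dvd: "mpoly_of_poly3 p dvd mpoly_of_poly3 q \<longleftrightarrow> p dvd q" for p q :: "'k poly poly poly"
  proof
    assume "mpoly_of_poly3 p dvd mpoly_of_poly3 q"
    then obtain r where "mpoly_of_poly3 q = mpoly_of_poly3 (p * r)"
      using surj by (metis dvdE hom_mult)
    then show "p dvd q" by simp
  next
    assume "p dvd q"
    then show "mpoly_of_poly3 p dvd mpoly_of_poly3 q"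
      by (metis dvd_def hom_mult)
  qed
  then have unit: "mpoly_of_poly3 p dvd 1 \<longleftrightarrow> p dvd 1" for p :: "'k poly poly poly"
    by (metis hom_one)
  obtain p where p: "f = mpoly_of_poly3 p" using surj by blast
  have "irreducible p"
    using assms unfolding irreducible_def p by (metis inj.hom_0_iff unit hom_mult)
  \<comment> \<open>Gauss's lemma enters here: a polynomial ring over a factorial ring is factorial,
    so irreducible elements of k[x][y][z] are prime.\<close>
  then have "prime_elem p" by simp
  then show ?thesis
    unfolding prime_elem_def p by (metis inj.hom_0_iff unit dvd hom_mult surj)
qed

section \<open>Koszul exactness and the Hilbert--Burch ideal\<close>

text \<open>With l = (l1, l2, l3), \<open>syzygy\<close> says that a vector orthogonal to l is a
  cross product l x (p, q, r), and \<open>proportional\<close> that a vector with zero cross product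
  with l is a multiple of l. These are the two middle exactness conditions of the Koszul complex;
  \<open>proper\<close> says that the l's generate a proper ideal.\<close>

locale koszul_exact =
  fixes l1 l2 l3 :: "'a::idom"
  assumes syzygy: "a * l1 + b * l2 + c * l3 = 0 \<Longrightarrow>
      \<exists>p q r. a = l2 * r - l3 * q \<and> b = l3 * p - l1 * r \<and> c = l1 * q - l2 * p"
    and proportional: "l1 * b = l2 * a \<Longrightarrow> l2 * c = l3 * b \<Longrightarrow> l1 * c = l3 * a \<Longrightarrow>
      \<exists>t. a = t * l1 \<and> b = t * l2 \<and> c = t * l3"
    and proper: "a * l1 + b * l2 + c * l3 \<noteq> 1"
begin

text \<open>If some l vanished, the corresponding unit vector would be a syzygy, and its Koszul form
  would put 1 into the ideal of the l's.\<close>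

lemma nonzero: "l1 \<noteq> 0" "l2 \<noteq> 0" "l3 \<noteq> 0"
proof -
  show "l1 \<noteq> 0"
  proof
    assume "l1 = 0"
    then obtain q r where "1 = l2 * r - l3 * q" using syzygy[of 1 0 0] by auto
    then show False using proper[of 0 r "- q"] by (simp add: mult.commute)
  qed
  show "l2 \<noteq> 0"
  proof
    assume "l2 = 0"
    then obtain p r where "1 = l3 * p - l1 * r" using syzygy[of 0 1 0] by auto
    then show False using proper[of "- r" 0 p] by (simp add: mult.commute)
  qed
  show "l3 \<noteq> 0"
  proof
    assume "l3 = 0"
    then obtain p q where "1 = l1 * q - l2 * p" using syzygy[of 0 0 1] by auto
    then show False using proper[of q "- p" 0] by (simp add: mult.commute)
  qed
qed

text \<open>This is \<open>proportional\<close> modulo \<open>f\<close>. Write the cross product of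
  l and (a, b, c) as f (u, v, w). Its scalar product with l is zero, so (u, v, w) is itself a cross
  product l x (p, q, r), and (a, b, c) - f (p, q, r) is honestly proportional to l.\<close>

lemma proportional_mod:
  assumes "f \<noteq> 0" and "f dvd l1 * b - l2 * a" and "f dvd l2 * c - l3 * b" and "f dvd l3 * a - l1 * c"
  shows "\<exists>t p q r. a = t * l1 + f * p \<and> b = t * l2 + f * q \<and> c = t * l3 + f * r"
proof -
  obtain u v w where u: "l2 * c - l3 * b = f * u" and v: "l3 * a - l1 * c = f * v"
    and w: "l1 * b - l2 * a = f * w"
    using assms(2-4) by (metis dvdE)
  have "f * (u * l1 + v * l2 + w * l3) = 0"
    using u v w by Groebner_Basis.algebra
  then have "u * l1 + v * l2 + w * l3 = 0" using \<open>f \<noteq> 0\<close> by simp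
  then obtain p q r where *: "u = l2 * r - l3 * q" "v = l3 * p - l1 * r" "w = l1 * q - l2 * p"
    using syzygy by blast
  have "l1 * (b - f * q) = l2 * (a - f * p)" "l2 * (c - f * r) = l3 * (b - f * q)"
    "l1 * (c - f * r) = l3 * (a - f * p)"
    using u v w unfolding * by Groebner_Basis.algebra+
  from proportional[OF this] obtain t
    where "a - f * p = t * l1" "b - f * q = t * l2" "c - f * r = t * l3" by blast
  then have "a = t * l1 + f * p \<and> b = t * l2 + f * q \<and> c = t * l3 + f * r"
    by (simp add: algebra_simps)
  then show ?thesis by blast
qed

end

text \<open>Each \<open>f\<close> is a factor of two of the generators \<open>g1\<close>,
  \<open>g2\<close>, \<open>g3\<close>; \<open>not_dvd\<close> pairs it with the linear form of the
  third one, which it therefore does not divide.\<close>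

locale hilbert_burch = koszul_exact l1 l2 l3 for l1 l2 l3 :: "'a::idom" +
  fixes f1 f2 f3 :: 'a
  assumes prime: "prime_elem f1" "prime_elem f2" "prime_elem f3"
    and coprime: "\<not> f1 dvd f2" "\<not> f2 dvd f1" "\<not> f1 dvd f3" "\<not> f3 dvd f1" "\<not> f2 dvd f3" "\<not> f3 dvd f2"
    and not_dvd: "\<not> f1 dvd l2" "\<not> f2 dvd l3" "\<not> f3 dvd l1"
begin

abbreviation "g1 \<equiv> l1 * f1 * f2"
abbreviation "g2 \<equiv> l2 * f2 * f3"
abbreviation "g3 \<equiv> l3 * f1 * f3"

lemma f_nonzero: "f1 \<noteq> 0" "f2 \<noteq> 0" "f3 \<noteq> 0"
  using prime by auto

text \<open>Modulo \<open>f3\<close> only the first term survives, and the prime \<open>f3\<close>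
  divides none of \<open>l1\<close>, \<open>f1\<close>, \<open>f2\<close>; the other two cases are
  alike. The fourth term lets one lemma serve both the resolution (with d = 0) and the
  saturation.\<close>

lemma syzygy_dvd:
  assumes "a * g1 + b * g2 + c * g3 + d * (f1 * f2 * f3) = 0"
  shows "f3 dvd a" "f1 dvd b" "f2 dvd c"
proof -
  have "a * l1 * f1 * f2 = f3 * (- b * l2 * f2 - c * l3 * f1 - d * f1 * f2)"
    using assms by Groebner_Basis.algebra
  then have "f3 dvd a * l1 * f1 * f2" by (metis dvd_triv_left)
  then show "f3 dvd a" using prime coprime not_dvd by (auto simp: prime_elem_dvd_mult_iff)
  have "b * l2 * f2 * f3 = f1 * (- a * l1 * f2 - c * l3 * f3 - d * f2 * f3)"
    using assms by Groebner_Basis.algebra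
  then have "f1 dvd b * l2 * f2 * f3" by (metis dvd_triv_left)
  then show "f1 dvd b" using prime coprime not_dvd by (auto simp: prime_elem_dvd_mult_iff)
  have "c * l3 * f1 * f3 = f2 * (- a * l1 * f1 - b * l2 * f3 - d * f1 * f3)"
    using assms by Groebner_Basis.algebra
  then have "f2 dvd c * l3 * f1 * f3" by (metis dvd_triv_left)
  then show "f2 dvd c" using prime coprime not_dvd by (auto simp: prime_elem_dvd_mult_iff)
qed

text \<open>Once the forced factors are split off, each term is a multiple of
  \<open>f1 * f2 * f3\<close>, which cancels. The remaining relation determines \<open>d\<close>, so
  the syzygies of the four generators are parametrized by a', b', c': this is the Hilbert--Burch
  matrix.\<close>

lemma syzygy_factor:
  assumes "a * g1 + b * g2 + c * g3 + d * (f1 * f2 * f3) = 0"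
  obtains a' b' c' where "a = f3 * a'" "b = f1 * b'" "c = f2 * c'"
    "a' * l1 + b' * l2 + c' * l3 + d = 0"
proof -
  obtain a' b' c' where *: "a = f3 * a'" "b = f1 * b'" "c = f2 * c'"
    using syzygy_dvd[OF assms] by (metis dvdE)
  have "(f1 * f2 * f3) * (a' * l1 + b' * l2 + c' * l3 + d) = 0"
    using assms unfolding * by Groebner_Basis.algebra
  then show thesis using that * f_nonzero by simp
qed

text \<open>Such a representation is a syzygy with d = -1, and its reduced relation would place 1 in
  the ideal of the linear forms.\<close>

lemma product_not_generated: "f1 * f2 * f3 \<noteq> a * g1 + b * g2 + c * g3"
proof
  assume "f1 * f2 * f3 = a * g1 + b * g2 + c * g3"
  then have "a * g1 + b * g2 + c * g3 + (- 1) * (f1 * f2 * f3) = 0" by simp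
  then obtain a' b' c' where "a' * l1 + b' * l2 + c' * l3 + (- 1) = 0"
    using syzygy_factor by blast
  then show False using proper[of a' b' c'] by simp
qed

lemma first_syzygies:
  "a * g1 + b * g2 + c * g3 = 0 \<longleftrightarrow>
    (\<exists>x y z. a = l2 * f3 * x - l3 * f3 * y \<and> b = - (l1 * f1) * x + l3 * f1 * z \<and>
      c = l1 * f2 * y - l2 * f2 * z)" (is "?l \<longleftrightarrow> ?r")
proof
  assume ?l
  then have "a * g1 + b * g2 + c * g3 + 0 * (f1 * f2 * f3) = 0" by simp
  then obtain a' b' c' where *: "a = f3 * a'" "b = f1 * b'" "c = f2 * c'"
    and "a' * l1 + b' * l2 + c' * l3 = 0"
    using syzygy_factor by (metis add.right_neutral)
  then obtain p q r where "a' = l2 * r - l3 * q" "b' = l3 * p - l1 * r" "c' = l1 * q - l2 * p"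
    using syzygy by blast
  \<comment> \<open>The columns of \<phi> are the three Koszul syzygies in reverse order, hence (x,
    y, z) = (r, q, p).\<close>
  then have "a = l2 * f3 * r - l3 * f3 * q \<and> b = - (l1 * f1) * r + l3 * f1 * p \<and>
      c = l1 * f2 * q - l2 * f2 * p"
    by (simp add: * right_diff_distrib mult_ac)
  then show ?r by blast
next
  assume ?r
  then obtain x y z where "a = l2 * f3 * x - l3 * f3 * y" "b = - (l1 * f1) * x + l3 * f1 * z"
    "c = l1 * f2 * y - l2 * f2 * z" by blast
  then show ?l by Groebner_Basis.algebra
qed

text \<open>After cancelling \<open>f3\<close>, \<open>f1\<close>, \<open>f2\<close> the three
  equations say that the reversed vector (z, y, x) has zero cross product with (l1, l2, l3), so it
  is a multiple of it.\<close>

lemma second_syzygies: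
  "l2 * f3 * x - l3 * f3 * y = 0 \<and> - (l1 * f1) * x + l3 * f1 * z = 0 \<and> l1 * f2 * y - l2 * f2 * z = 0 \<longleftrightarrow>
    (\<exists>t. x = l3 * t \<and> y = l2 * t \<and> z = l1 * t)" (is "?l \<longleftrightarrow> ?r")
proof
  assume ?l
  then have "f3 * (l2 * x - l3 * y) = 0" "f1 * (l3 * z - l1 * x) = 0" "f2 * (l1 * y - l2 * z) = 0"
    by (simp_all add: algebra_simps)
  then have "l2 * x = l3 * y" "l1 * x = l3 * z" "l1 * y = l2 * z"
    using f_nonzero by simp_all
  then show ?r using proportional[of y z x] by (metis mult.commute)
qed (auto simp: algebra_simps)

text \<open>The ideal \<open>(g1, g2, g3, f1 f2 f3)\<close> is generated by the maximal minors of a 4 by 3 matrix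
  (Hilbert--Burch), so its quotient has projective dimension 2 and therefore positive depth.
  The proof chases the Koszul complex of \<open>l1, l2, l3\<close> through the resolution.\<close>

lemma saturated_step:
  assumes "l1 * g = a1 * g1 + b1 * g2 + c1 * g3 + d1 * (f1 * f2 * f3)"
    and "l2 * g = a2 * g1 + b2 * g2 + c2 * g3 + d2 * (f1 * f2 * f3)"
    and "l3 * g = a3 * g1 + b3 * g2 + c3 * g3 + d3 * (f1 * f2 * f3)"
  shows "\<exists>a b c d. g = a * g1 + b * g2 + c * g3 + d * (f1 * f2 * f3)"
proof -
  \<comment> \<open>Comparing two expressions for \<open>l1 * l2 * g\<close> gives a syzygy. By
    \<open>syzygy_dvd\<close> the cross products of l with (a1, a2, a3), (b1, b2, b3), (c1, c2, c3)
    are divisible by \<open>f3\<close>, \<open>f1\<close>, \<open>f2\<close> respectively.\<close>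
  have "(l1 * a2 - l2 * a1) * g1 + (l1 * b2 - l2 * b1) * g2 + (l1 * c2 - l2 * c1) * g3
      + (l1 * d2 - l2 * d1) * (f1 * f2 * f3) = 0"
    using assms by Groebner_Basis.algebra
  note s12 = syzygy_dvd[OF this]
  have "(l2 * a3 - l3 * a2) * g1 + (l2 * b3 - l3 * b2) * g2 + (l2 * c3 - l3 * c2) * g3
      + (l2 * d3 - l3 * d2) * (f1 * f2 * f3) = 0"
    using assms by Groebner_Basis.algebra
  note s23 = syzygy_dvd[OF this]
  have "(l3 * a1 - l1 * a3) * g1 + (l3 * b1 - l1 * b3) * g2 + (l3 * c1 - l1 * c3) * g3
      + (l3 * d1 - l1 * d3) * (f1 * f2 * f3) = 0"
    using assms by Groebner_Basis.algebra
  note s31 = syzygy_dvd[OF this]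
  obtain a p1 p2 p3 where a: "a1 = a * l1 + f3 * p1" "a2 = a * l2 + f3 * p2" "a3 = a * l3 + f3 * p3"
    using proportional_mod[OF f_nonzero(3) s12(1) s23(1) s31(1)] by blast
  obtain b q1 q2 q3 where b: "b1 = b * l1 + f1 * q1" "b2 = b * l2 + f1 * q2" "b3 = b * l3 + f1 * q3"
    using proportional_mod[OF f_nonzero(1) s12(2) s23(2) s31(2)] by blast
  obtain c r1 r2 r3 where c: "c1 = c * l1 + f2 * r1" "c2 = c * l2 + f2 * r2" "c3 = c * l3 + f2 * r3"
    using proportional_mod[OF f_nonzero(2) s12(3) s23(3) s31(3)] by blast
  define h where "h = f1 * f2 * f3"
  \<comment> \<open>Removing the proportional parts from \<open>g\<close> leaves \<open>G\<close>.
    Since \<open>f3 * g1 = l1 * h\<close>, \<open>f1 * g2 = l2 * h\<close> and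
    \<open>f2 * g3 = l3 * h\<close>, what remains of each \<open>l_i * G\<close> is a multiple of
    \<open>h\<close>.\<close>
  define G where "G = g - a * g1 - b * g2 - c * g3"
  define D1 where "D1 = l1 * p1 + l2 * q1 + l3 * r1 + d1"
  define D2 where "D2 = l1 * p2 + l2 * q2 + l3 * r2 + d2"
  define D3 where "D3 = l1 * p3 + l2 * q3 + l3 * r3 + d3"
  have D: "l1 * G = h * D1" "l2 * G = h * D2" "l3 * G = h * D3"
    using assms unfolding G_def h_def D1_def D2_def D3_def a b c by Groebner_Basis.algebra+
  have "h \<noteq> 0" using f_nonzero by (simp add: h_def)
  \<comment> \<open>Both sides equal \<open>l1 * l2 * G\<close>, and similarly for the other pairs;
    cancelling \<open>h\<close> makes (D1, D2, D3) proportional to l.\<close>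
  moreover have "h * (l1 * D2) = h * (l2 * D1)" "h * (l2 * D3) = h * (l3 * D2)"
    "h * (l1 * D3) = h * (l3 * D1)"
    using D by Groebner_Basis.algebra+
  ultimately have "l1 * D2 = l2 * D1" "l2 * D3 = l3 * D2" "l1 * D3 = l3 * D1" by simp_all
  then obtain t where "D1 = t * l1" using proportional by blast
  then have "l1 * G = l1 * (t * h)" using D(1) by (simp add: ac_simps)
  then have "G = t * h" using nonzero by simp
  then have "g = a * g1 + b * g2 + c * g3 + t * (f1 * f2 * f3)"
    unfolding G_def h_def by (simp add: algebra_simps)
  then show ?thesis by blast
qed

end

section \<open>Linear forms\<close>

lemma mpoly_eq_sum_single:
  "f = (\<Sum>m\<in>Poly_Mapping.keys f. Poly_Mapping.single m (Poly_Mapping.lookup f m))"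
  by (intro poly_mapping_eqI)
    (simp add: Poly_Mapping.lookup_sum lookup_single when_def in_keys_iff)

text \<open>Division with remainder by a variable: \<open>g\<close> collects the monomials without
  \<open>v\<close>, and \<open>q\<close> the others with one \<open>v\<close> removed. Neither
  operation introduces new variables, so repeated splitting keeps what was already achieved.\<close>

lemma free_of_split:
  fixes f :: "('v, 'k::comm_ring_1) mpoly"
  obtains g q where "f = g + mvar v * q" "g \<in> free_of v"
    "\<And>w. f \<in> free_of w \<Longrightarrow> g \<in> free_of w" "\<And>w. f \<in> free_of w \<Longrightarrow> q \<in> free_of w"
proof -
  define K where "K = {m \<in> Poly_Mapping.keys f. Poly_Mapping.lookup m v = 0}"
  define g where "g = (\<Sum>m\<in>K. Poly_Mapping.single m (Poly_Mapping.lookup f m))"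
  define q where "q = (\<Sum>m\<in>Poly_Mapping.keys f - K.
    Poly_Mapping.single (m - Poly_Mapping.single v 1) (Poly_Mapping.lookup f m))"
  have "mvar v * q = (\<Sum>m\<in>Poly_Mapping.keys f - K. Poly_Mapping.single m (Poly_Mapping.lookup f m))"
    unfolding q_def sum_distrib_left
  proof (intro sum.cong refl)
    fix m assume "m \<in> Poly_Mapping.keys f - K"
    then have "Poly_Mapping.single v 1 + (m - Poly_Mapping.single v 1) = m"
      by (intro poly_mapping_eqI)
        (auto simp: K_def Poly_Mapping.lookup_add lookup_minus lookup_single when_def)
    then show "mvar v * Poly_Mapping.single (m - Poly_Mapping.single v 1) (Poly_Mapping.lookup f m)
        = Poly_Mapping.single m (Poly_Mapping.lookup f m)"
      by (simp add: mvar_def mult_single)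
  qed
  then have "f = g + mvar v * q"
    unfolding g_def using mpoly_eq_sum_single[of f]
    by (simp add: K_def sum.subset_diff[of "{m \<in> Poly_Mapping.keys f. Poly_Mapping.lookup m v = 0}"
          "Poly_Mapping.keys f"] add.commute)
  moreover have kg: "Poly_Mapping.keys g \<subseteq> K"
    unfolding g_def by (rule order_trans[OF keys_sum]) (auto split: if_splits)
  moreover have kq: "\<exists>n\<in>Poly_Mapping.keys f. m = n - Poly_Mapping.single v 1"
    if "m \<in> Poly_Mapping.keys q" for m
    using that subsetD[OF keys_sum] unfolding q_def by (fastforce split: if_splits)
  ultimately show thesis
    by (intro that[of g q]) (fastforce simp: free_of_def K_def lookup_minus)+
qed

lemma free_of_cancel:
  fixes p q :: "('v::linorder, 'k::field) mpoly"
  assumes "mvar v * p + q = 0" and "q \<in> free_of v"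
  shows "p = 0" "q = 0"
proof -
  have "mvar v * p = - q" using assms(1) by (simp add: eq_neg_iff_add_eq_0)
  then show "p = 0" using assms(2) free_of_uminus mvar_mult_free_ofD by metis
  then show "q = 0" using assms(1) by simp
qed

section \<open>Degrees and homogeneous polynomials\<close>

lemma mdeg_eq_sum: "mdeg (m :: 'v::finite \<Rightarrow>\<^sub>0 nat) = (\<Sum>v\<in>UNIV. Poly_Mapping.lookup m v)"
  unfolding mdeg_def by (intro sum.mono_neutral_left) (auto simp: in_keys_iff)

lemma mdeg_add: "mdeg (m + n) = mdeg m + mdeg (n :: 'v::finite \<Rightarrow>\<^sub>0 nat)"
  by (simp add: mdeg_eq_sum Poly_Mapping.lookup_add sum.distrib)

lemma homogeneous_mult:
  fixes f g :: "('v::finite, 'k::comm_ring_1) mpoly"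
  shows "homogeneous d f \<Longrightarrow> homogeneous e g \<Longrightarrow> homogeneous (d + e) (f * g)"
  unfolding homogeneous_def by (auto dest!: subsetD[OF Poly_Mapping.keys_mult] simp: mdeg_add)

lemma homogeneous_uminus: "homogeneous d f \<Longrightarrow> homogeneous d (- f)"
  by (simp add: homogeneous_def)

text \<open>A monomial of \<open>g\<close> is a monomial of \<open>f\<close> times a monomial of the
  cofactor, whatever the cofactor is.\<close>

lemma homogeneous_dvd_degree_le:
  fixes f g :: "('v::finite, 'k::comm_ring_1) mpoly"
  assumes "homogeneous d f" and "homogeneous e g" and "f dvd g" and "g \<noteq> 0"
  shows "d \<le> e"
proof -
  obtain h where h: "g = f * h" using \<open>f dvd g\<close> by (rule dvdE)
  obtain m where m: "m \<in> Poly_Mapping.keys g"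
    using \<open>g \<noteq> 0\<close> by (metis keys_eq_empty ex_in_conv)
  then obtain m1 m2 where "m = m1 + m2" "m1 \<in> Poly_Mapping.keys f"
    using Poly_Mapping.keys_mult[of f h] unfolding h by blast
  then show ?thesis
    using assms(1,2) m unfolding homogeneous_def by (metis mdeg_add le_add1)
qed

text \<open>Elements of (x, y, z) have no constant term; this yields \<open>proper\<close> for the
  variables.\<close>

lemma lookup_mult_homogeneous_zero:
  fixes f g :: "('v::finite, 'k::comm_ring_1) mpoly"
  assumes "homogeneous 1 g"
  shows "Poly_Mapping.lookup (f * g) 0 = 0"
proof (rule ccontr)
  assume "\<not> ?thesis"
  then obtain m n where mn: "0 = m + n" and n: "n \<in> Poly_Mapping.keys g"
    using Poly_Mapping.keys_mult[of f g] by (auto simp: in_keys_iff)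
  have "mdeg m + mdeg n = mdeg (0 :: 'v \<Rightarrow>\<^sub>0 nat)"
    unfolding mn by (simp add: mdeg_add)
  moreover have "mdeg n = 1" using assms n by (simp add: homogeneous_def)
  ultimately show False by (simp add: mdeg_def)
qed

lemma homogeneous_mvar: "homogeneous 1 (mvar v :: ('v::finite, 'k::comm_ring_1) mpoly)"
  by (auto simp: homogeneous_def mvar_def mdeg_def)

lemma homogeneous_1_eq_sum:
  fixes l :: "('v::finite, 'k::comm_ring_1) mpoly"
  assumes "homogeneous 1 l"
  shows "l = (\<Sum>v\<in>UNIV. mconst (Poly_Mapping.lookup l (Poly_Mapping.single v 1)) * mvar v)"
proof (rule poly_mapping_eqI)
  fix m
  have r: "Poly_Mapping.lookup (\<Sum>v\<in>UNIV. mconst (Poly_Mapping.lookup l (Poly_Mapping.single v 1)) * mvar v) m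
      = (\<Sum>v\<in>UNIV. if Poly_Mapping.single v 1 = m then Poly_Mapping.lookup l m else 0)"
    by (auto simp: Poly_Mapping.lookup_sum mconst_def mvar_def mult_single lookup_single when_def
        intro!: sum.cong)
  show "Poly_Mapping.lookup l m = Poly_Mapping.lookup
      (\<Sum>v\<in>UNIV. mconst (Poly_Mapping.lookup l (Poly_Mapping.single v 1)) * mvar v) m"
  proof (cases "\<exists>w. m = Poly_Mapping.single w (1::nat)")
    case True
    then obtain w where w: "m = Poly_Mapping.single w 1" by blast
    have "Poly_Mapping.single v (1::nat) = m \<longleftrightarrow> v = w" for v
      unfolding w by (metis keys_single singleton_inject zero_neq_one)
    then show ?thesis unfolding r by simp
  next
    case False
    have "m \<notin> Poly_Mapping.keys l"
    proof
      assume "m \<in> Poly_Mapping.keys l"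
      then have "(\<Sum>v\<in>UNIV. Poly_Mapping.lookup m v) = 1"
        using assms by (simp add: homogeneous_def mdeg_eq_sum)
      then obtain w where "Poly_Mapping.lookup m w = 1" "\<And>v. v \<noteq> w \<Longrightarrow> Poly_Mapping.lookup m v = 0"
        using sum_eq_1_iff[of UNIV "Poly_Mapping.lookup m"] by auto
      then have "m = Poly_Mapping.single w 1"
        by (intro poly_mapping_eqI) (auto simp: lookup_single when_def)
      with False show False by blast
    qed
    then show ?thesis unfolding r in_keys_iff by (simp cong: if_cong)
  qed
qed

section \<open>Koszul exactness of the variables and of independent linear forms\<close>

lemma koszul_exact_mvar: "koszul_exact (mvar 1) (mvar 2) (mvar 3 :: (3, 'k::field) mpoly)"
proof
  let ?x = "mvar 1 :: (3, 'k) mpoly" and ?y = "mvar 2 :: (3, 'k) mpoly" and ?z = "mvar 3 :: (3, 'k) mpoly"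
  have d: "(1::3) \<noteq> 2" "(1::3) \<noteq> 3" "(2::3) \<noteq> 3" "(2::3) \<noteq> 1" "(3::3) \<noteq> 1" "(3::3) \<noteq> 2"
    by simp_all
  note free = free_of_add free_of_mult free_of_mvar d
  fix a b c :: "(3, 'k) mpoly"
  show "a * ?x + b * ?y + c * ?z \<noteq> 1"
  proof
    assume "a * ?x + b * ?y + c * ?z = 1"
    then have "Poly_Mapping.lookup (a * ?x + b * ?y + c * ?z) 0 = 1" by simp
    then show False
      by (simp add: Poly_Mapping.lookup_add lookup_mult_homogeneous_zero homogeneous_mvar del: One_nat_def)
  qed
  show "\<exists>p q r. a = ?y * r - ?z * q \<and> b = ?z * p - ?x * r \<and> c = ?x * q - ?y * p"
    if "a * ?x + b * ?y + c * ?z = 0"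
  proof -
    \<comment> \<open>Write b = b0 + x r and c = c1 + y q + x p. The part of the relation without x
      vanishes, and within it the part without y, so c1 = 0, b0 = - z q and a = - y r - z p. The
      Koszul coefficients are therefore (-q, p, -r).\<close>
    obtain b0 r where b: "b = b0 + ?x * r" "b0 \<in> free_of 1" using free_of_split by metis
    obtain c0 p where c: "c = c0 + ?x * p" "c0 \<in> free_of 1" using free_of_split by metis
    obtain c1 q where c0: "c0 = c1 + ?y * q" "c1 \<in> free_of 2" "c1 \<in> free_of 1" "q \<in> free_of 1"
      using free_of_split[of c0 2] c(2) by metis
    have 1: "?x * (a + ?y * r + ?z * p) + (?y * (b0 + ?z * q) + ?z * c1) = 0"
      using that unfolding b c c0 by (simp add: algebra_simps)
    moreover have "?y * (b0 + ?z * q) + ?z * c1 \<in> free_of 1"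
      using b c0 by (intro free)
    ultimately have a: "a + ?y * r + ?z * p = 0" and 2: "?y * (b0 + ?z * q) + ?z * c1 = 0"
      using free_of_cancel by blast+
    have "?z * c1 \<in> free_of 2" using c0 by (intro free)
    then have b0: "b0 + ?z * q = 0" and "?z * c1 = 0" using free_of_cancel[OF 2] by blast+
    then have "c1 = 0"
      using mvar_mult_free_ofD[of 3 c1] free_of_zero by metis
    have "a = ?y * (- r) - ?z * p" using a by (subst eq_iff_diff_eq_0) (simp add: algebra_simps)
    moreover have "b = ?z * (- q) - ?x * (- r)" 
      unfolding b using b0 by (simp add: eq_neg_iff_add_eq_0 mult.commute)
    moreover have "c = ?x * p - ?y * (- q)" unfolding c c0 \<open>c1 = 0\<close> by (simp add: algebra_simps)
    ultimately show ?thesis by blast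
  qed
  show "\<exists>t. a = t * ?x \<and> b = t * ?y \<and> c = t * ?z"
    if h: "?x * b = ?y * a" "?y * c = ?z * b" "?x * c = ?z * a"
  proof -
    \<comment> \<open>The part of x b = y a without x is y a0, so a0 = 0 and a = x t; cancelling x
      in the first and third equations gives b = y t and c = z t.\<close>
    obtain a0 t where a: "a = a0 + ?x * t" "a0 \<in> free_of 1" using free_of_split by metis
    have "?x * (?y * t - b) + ?y * a0 = 0" 
      using h(1) unfolding a by (simp add: algebra_simps)
    moreover have "?y * a0 \<in> free_of 1" using a by (intro free)
    ultimately have b: "?y * t - b = 0" and "?y * a0 = 0" using free_of_cancel by blast+
    then have "a0 = 0" using mvar_mult_free_ofD[of 2 a0] free_of_zero by metis
    then have "?x * (?z * t - c) = 0" 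
      using h(3) unfolding a by (auto simp: algebra_simps)
    then have "?z * t - c = 0" using mvar_mult_free_ofD[of 1] free_of_zero by metis
    then show ?thesis using a b \<open>a0 = 0\<close> by (intro exI[of _ t]) (simp add: mult.commute)
  qed
qed

text \<open>The Koszul complexes of \<open>x\<close> and of \<open>l\<close> are isomorphic through
  \<open>A\<close>, its inverse \<open>B\<close> and their minors; the exactness statements are
  moved along this isomorphism.\<close>

lemma koszul_exact_linear_change:
  fixes x l :: "3 \<Rightarrow> 'a::idom" and A B :: "3 \<Rightarrow> 3 \<Rightarrow> 'a"
  assumes "koszul_exact (x 1) (x 2) (x 3)"
    and l: "\<And>i. l i = (\<Sum>j\<in>UNIV. A i j * x j)" and x: "\<And>j. x j = (\<Sum>i\<in>UNIV. B j i * l i)"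
    and AB: "\<And>i k. (\<Sum>j\<in>UNIV. A i j * B j k) = (if i = k then 1 else 0)"
  shows "koszul_exact (l 1) (l 2) (l 3)"
proof -
  interpret koszul_exact "x 1" "x 2" "x 3" by fact
  note x' = x[of 1, unfolded sum_3] x[of 2, unfolded sum_3] x[of 3, unfolded sum_3]
  have AB': "A i 1 * B 1 k + A i 2 * B 2 k + A i 3 * B 3 k = (if i = k then 1 else 0)" for i k
    using AB[of i k] by (simp add: sum_3)
  note AB1 = AB'[of 1 1, simplified] AB'[of 2 1, simplified] AB'[of 3 1, simplified]
  note AB2 = AB'[of 1 2, simplified] AB'[of 2 2, simplified] AB'[of 3 2, simplified]
  note AB3 = AB'[of 1 3, simplified] AB'[of 2 3, simplified] AB'[of 3 3, simplified]
  show ?thesis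
  proof
    fix a b c
    define u where "u j = a * A 1 j + b * A 2 j + c * A 3 j" for j
    have ux: "u 1 * x 1 + u 2 * x 2 + u 3 * x 3 = a * l 1 + b * l 2 + c * l 3"
      unfolding l u_def sum_3 by (simp add: algebra_simps)
    show "a * l 1 + b * l 2 + c * l 3 \<noteq> 1"
      using proper ux by metis
    assume "a * l 1 + b * l 2 + c * l 3 = 0"
    then obtain p q r where u: "u 1 = x 2 * r - x 3 * q" "u 2 = x 3 * p - x 1 * r" "u 3 = x 1 * q - x 2 * p"
      using syzygy ux by metis
    have uB: "u 1 * B 1 k + u 2 * B 2 k + u 3 * B 3 k
        = a * (if 1 = k then 1 else 0) + b * (if 2 = k then 1 else 0) + c * (if 3 = k then 1 else 0)" for k
      unfolding AB'[symmetric] u_def by (simp add: algebra_simps)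
    \<comment> \<open>The coefficients transform by the second exterior power of \<open>B\<close>:
      \<open>P\<close>, \<open>Q\<close>, \<open>R\<close> are combinations of p, q, r with 2 by 2
      minors from columns 2 and 3, 1 and 3, 1 and 2 of \<open>B\<close>.\<close>
    define P where "P = (B 2 3 * r - B 3 3 * q) * B 1 2 + (B 3 3 * p - B 1 3 * r) * B 2 2
      + (B 1 3 * q - B 2 3 * p) * B 3 2"
    define Q where "Q = (B 2 1 * r - B 3 1 * q) * B 1 3 + (B 3 1 * p - B 1 1 * r) * B 2 3
      + (B 1 1 * q - B 2 1 * p) * B 3 3"
    define R where "R = (B 2 2 * r - B 3 2 * q) * B 1 1 + (B 3 2 * p - B 1 2 * r) * B 2 1
      + (B 1 2 * q - B 2 2 * p) * B 3 1"
    have "a = u 1 * B 1 1 + u 2 * B 2 1 + u 3 * B 3 1" "b = u 1 * B 1 2 + u 2 * B 2 2 + u 3 * B 3 2"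
      "c = u 1 * B 1 3 + u 2 * B 2 3 + u 3 * B 3 3"
      unfolding uB by simp_all
    then have "a = l 2 * R - l 3 * Q \<and> b = l 3 * P - l 1 * R \<and> c = l 1 * Q - l 2 * P"
      unfolding u x' P_def Q_def R_def by (simp add: algebra_simps)
    then show "\<exists>p q r. a = l 2 * r - l 3 * q \<and> b = l 3 * p - l 1 * r \<and> c = l 1 * q - l 2 * p"
      by blast
  next
    fix a b c
    assume h: "l 1 * b = l 2 * a" "l 2 * c = l 3 * b" "l 1 * c = l 3 * a"
    define v where "v j = B j 1 * a + B j 2 * b + B j 3 * c" for j
    have "x i * v j = x j * v i" for i j
    proof -
      \<comment> \<open>The cross product of \<open>x\<close> and \<open>v\<close> is a combination,
        with 2 by 2 minors of \<open>B\<close>, of the cross product of \<open>l\<close> and (a, b,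
        c), which vanishes.\<close>
      have "x i * v j - x j * v i = (B i 1 * B j 2 - B i 2 * B j 1) * (l 1 * b - l 2 * a)
          + (B i 2 * B j 3 - B i 3 * B j 2) * (l 2 * c - l 3 * b)
          + (B i 1 * B j 3 - B i 3 * B j 1) * (l 1 * c - l 3 * a)"
        unfolding v_def x[of i] x[of j] sum_3 by (simp add: algebra_simps)
      then show ?thesis by (simp add: h)
    qed
    then obtain t where v: "v 1 = t * x 1" "v 2 = t * x 2" "v 3 = t * x 3"
      using proportional[of "v 2" "v 1" "v 3"] by metis
    have Av: "A i 1 * v 1 + A i 2 * v 2 + A i 3 * v 3
        = (if i = 1 then 1 else 0) * a + (if i = 2 then 1 else 0) * b + (if i = 3 then 1 else 0) * c" for i
      unfolding AB'[symmetric] v_def by (simp add: algebra_simps)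
    have "a = t * l 1" using Av[of 1] unfolding v l[of 1] sum_3 by (simp add: algebra_simps)
    moreover have "b = t * l 2" using Av[of 2] unfolding v l[of 2] sum_3 by (simp add: algebra_simps)
    moreover have "c = t * l 3" using Av[of 3] unfolding v l[of 3] sum_3 by (simp add: algebra_simps)
    ultimately show "\<exists>t. a = t * l 1 \<and> b = t * l 2 \<and> c = t * l 3" by blast
  qed
qed

text \<open>Independence of the forms is independence of the rows of their coefficient matrix over
  k. The matrix thus has a right inverse, which is two-sided because it is square, and both are
  embedded in R as constants.\<close>

lemma independent_linear_forms_matrix:
  fixes L :: "(3, 'k::field) mpoly ^ 3"
  assumes L: "\<And>i. homogeneous 1 (L $ i)" and "forms_independent L"
  obtains A B :: "3 \<Rightarrow> 3 \<Rightarrow> (3, 'k) mpoly"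
  where "\<And>i. L $ i = (\<Sum>j\<in>UNIV. A i j * mvar j)" "\<And>j. mvar j = (\<Sum>i\<in>UNIV. B j i * L $ i)"
    "\<And>i k. (\<Sum>j\<in>UNIV. A i j * B j k) = (if i = k then 1 else 0)"
proof -
  interpret mc: comm_ring_hom "mconst :: 'k \<Rightarrow> (3, 'k) mpoly" by (rule mconst_hom)
  define A :: "'k ^ 3 ^ 3" where "A = (\<chi> i j. Poly_Mapping.lookup (L $ i) (Poly_Mapping.single j 1))"
  have LA: "L $ i = (\<Sum>j\<in>UNIV. mconst (A $ i $ j) * mvar j)" for i
    unfolding A_def using homogeneous_1_eq_sum[OF L] by simp
  have "\<forall>c. (\<Sum>i\<in>UNIV. c i *s Finite_Cartesian_Product.row i A) = 0 \<longrightarrow> (\<forall>i. c i = 0)"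
  proof (intro allI impI)
    fix c :: "3 \<Rightarrow> 'k" and i
    assume "(\<Sum>i\<in>UNIV. c i *s Finite_Cartesian_Product.row i A) = 0"
    then have c: "(\<Sum>i\<in>UNIV. c i * A $ i $ j) = 0" for j
      by (simp add: Finite_Cartesian_Product.vec_eq_iff Finite_Cartesian_Product.row_def)
    have "(\<Sum>i\<in>UNIV. mconst ((\<chi> i. c i) $ i) * L $ i) = (\<Sum>j\<in>UNIV. mconst (\<Sum>i\<in>UNIV. c i * A $ i $ j) * mvar j)"
      unfolding LA sum_3 by (simp add: mc.hom_add mc.hom_mult algebra_simps)
    also have "\<dots> = 0" by (simp add: c)
    finally have "(\<chi> i. c i) = (0 :: 'k ^ 3)"
      using assms(2) unfolding forms_independent_def by blast
    then show "c i = 0" by (simp add: Finite_Cartesian_Product.vec_eq_iff)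
  qed
  then have "\<exists>B. A ** B = Finite_Cartesian_Product.mat 1"
    by (rule matrix_right_invertible_independent_rows[THEN iffD2])
  then obtain B where AB: "A ** B = Finite_Cartesian_Product.mat 1" ..
  then have BA: "B ** A = Finite_Cartesian_Product.mat 1"
    by (simp add: matrix_left_right_inverse)
  have eq: "(\<Sum>j\<in>UNIV. mconst (M $ i $ j) * mconst (N $ j $ k)) = (if i = k then 1 else 0 :: (3, 'k) mpoly)"
    if "M ** N = Finite_Cartesian_Product.mat 1" for M N :: "'k ^ 3 ^ 3" and i k
  proof -
    have "(\<Sum>j\<in>UNIV. M $ i $ j * N $ j $ k) = (if i = k then 1 else 0)"
      using that by (simp add: Finite_Cartesian_Product.vec_eq_iff matrix_matrix_mult_def Finite_Cartesian_Product.mat_def)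
    then have "mconst (\<Sum>j\<in>UNIV. M $ i $ j * N $ j $ k) = (mconst (if i = k then 1 else 0) :: (3, 'k) mpoly)"
      by simp
    then show ?thesis by (simp add: sum_3 mc.hom_add mc.hom_mult split: if_splits)
  qed
  have "(\<Sum>i\<in>UNIV. mconst (B $ j $ i) * L $ i)
      = (\<Sum>k\<in>UNIV. (\<Sum>i\<in>UNIV. mconst (B $ j $ i) * mconst (A $ i $ k)) * mvar k)" for j
    unfolding LA sum_3 by (simp add: algebra_simps)
  then have "mvar j = (\<Sum>i\<in>UNIV. mconst (B $ j $ i) * L $ i)" for j
    unfolding eq[OF BA] by (simp add: if_distrib[of "\<lambda>c. c * _"] cong: if_cong)
  then show thesis
    using that[of "\<lambda>i j. mconst (A $ i $ j)" "\<lambda>i j. mconst (B $ i $ j)"] LA eq[OF AB] by blast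
qed

section \<open>Ideals and saturation\<close>

interpretation ring_module: Modules.module "(*) :: 'a::comm_ring_1 \<Rightarrow> 'a \<Rightarrow> 'a"
  by unfold_locales (auto simp: algebra_simps)

text \<open>With ring multiplication as scalar multiplication this rule regroups products to the
  left, opposite to \<open>mult.assoc\<close>.\<close>

declare ring_module.scale_scale [simp del]

lemma ideal_gen_insert: "x \<in> ideal_gen (insert a S) \<longleftrightarrow> (\<exists>u. \<exists>y\<in>ideal_gen S. x = u * a + y)"
proof -
  have "x \<in> ideal_gen (insert a S) \<longleftrightarrow> (\<exists>u. x - u * a \<in> ideal_gen S)"
    by (simp add: ideal_gen_def ring_module.span_insert)
  moreover have "x - u * a \<in> ideal_gen S \<longleftrightarrow> (\<exists>y\<in>ideal_gen S. x = u * a + y)" for u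
    by (metis add_diff_cancel_left' add.commute diff_add_cancel)
  ultimately show ?thesis by simp
qed

lemma ideal_gen_triple: "x \<in> ideal_gen {a, b, c} \<longleftrightarrow> (\<exists>u v w. x = u * a + v * b + w * c)"
proof -
  have "ideal_gen {} = {0 :: 'a}" by (simp add: ideal_gen_def ring_module.span_empty)
  then show ?thesis
    by (simp add: ideal_gen_insert Bex_def add.assoc) (metis add.right_neutral)
qed

lemma ideal_gen_ideal_gen_insert: "ideal_gen (ideal_gen S \<union> {h}) = ideal_gen (insert h S)"
proof -
  have "ideal_gen (ideal_gen S) = ideal_gen S"
    by (simp add: ideal_gen_def ring_module.span_span)
  then have "x \<in> ideal_gen (ideal_gen S \<union> {h}) \<longleftrightarrow> x \<in> ideal_gen (insert h S)" for x
    by (simp only: Un_insert_right Un_empty_right ideal_gen_insert)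
  then show ?thesis by blast
qed

text \<open>With m = \<open>max_ideal\<close>, the assumptions say that J : m lies in J and that m J
  lies in I. The first gives J : m^n inside J by induction on n, which bounds the saturation above;
  the second makes n = 1 a valid exponent for every element of J.\<close>

lemma saturation_eqI:
  assumes "I \<subseteq> J" and sat: "\<And>g. (\<And>a. a \<in> max_ideal \<Longrightarrow> a * g \<in> J) \<Longrightarrow> g \<in> J"
    and mult: "\<And>a g. a \<in> max_ideal \<Longrightarrow> g \<in> J \<Longrightarrow> a * g \<in> I"
  shows "saturation I = J"
proof
  have step: "g \<in> J" if "\<forall>h\<in>ideal_power max_ideal n. h * g \<in> J" for n g
    using that
  proof (induction n arbitrary: g)
    case 0
    then have "1 * g \<in> J" by (rule bspec) simp
    then show ?case by (simp only: mult_1)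
  next
    case (Suc n)
    have "h * g \<in> J" if "h \<in> ideal_power max_ideal n" for h
    proof (rule sat)
      fix a :: "(3, 'a) mpoly" assume "a \<in> max_ideal"
      then have "a * h \<in> ideal_power max_ideal (Suc n)"
        using that by (auto simp: ideal_gen_def intro!: ring_module.span_base)
      then have "a * h * g \<in> J" using Suc.prems by blast
      then show "a * (h * g) \<in> J" by (simp add: mult.assoc)
    qed
    then show ?case by (rule Suc.IH[OF ballI])
  qed
  show "saturation I \<subseteq> J"
  proof
    fix g assume "g \<in> saturation I"
    then obtain n where "\<forall>h\<in>ideal_power max_ideal n. h * g \<in> I"
      unfolding saturation_def by blast
    with \<open>I \<subseteq> J\<close> have "\<forall>h\<in>ideal_power max_ideal n. h * g \<in> J" by blast
    then show "g \<in> J" by (rule step)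
  qed
  have "ideal_power max_ideal 1 \<subseteq> (max_ideal :: (3, 'a) mpoly set)"
    unfolding One_nat_def ideal_power.simps max_ideal_def ideal_gen_def
    by (rule ring_module.span_minimal)
      (use ring_module.span_scale in \<open>force simp: mult.commute\<close>)+
  then have "\<forall>h\<in>ideal_power max_ideal 1. h * g \<in> I" if "g \<in> J" for g
    using mult that by (auto simp only:)
  then show "J \<subseteq> saturation I"
    unfolding saturation_def by (intro subsetI CollectI exI[of _ 1])
qed

lemma max_ideal_eq_ideal_gen_linear_forms:
  fixes L :: "(3, 'k::field) mpoly ^ 3"
  assumes "\<And>i. homogeneous 1 (L $ i)" and "forms_independent L"
  shows "max_ideal = ideal_gen (range (($) L))"
proof -
  obtain A B where A: "\<And>i. L $ i = (\<Sum>j\<in>UNIV. A i j * mvar j)"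
    and B: "\<And>j. mvar j = (\<Sum>i\<in>UNIV. B j i * L $ i)"
    and "\<And>i k. (\<Sum>j\<in>UNIV. A i j * B j k) = (if i = k then 1 else 0)"
    by (rule independent_linear_forms_matrix[OF assms]) (rule that)
  have "L $ i \<in> ring_module.span (range mvar)" for i
    unfolding A by (intro ring_module.span_sum ring_module.span_scale ring_module.span_base rangeI)
  moreover have "mvar i \<in> ring_module.span (range (($) L))" for i
    unfolding B by (intro ring_module.span_sum ring_module.span_scale ring_module.span_base rangeI)
  ultimately show ?thesis
    unfolding max_ideal_def ideal_gen_def
    by (intro equalityI ring_module.span_minimal) auto
qed

lemma koszul_exact_linear_forms:
  fixes L :: "(3, 'k::field) mpoly ^ 3"
  assumes "\<And>i. homogeneous 1 (L $ i)" and "forms_independent L"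
  shows "koszul_exact (L $ 1) (L $ 2) (L $ 3)"
proof -
  obtain A B where "\<And>i. L $ i = (\<Sum>j\<in>UNIV. A i j * mvar j)"
    "\<And>j. mvar j = (\<Sum>i\<in>UNIV. B j i * L $ i)"
    "\<And>i k. (\<Sum>j\<in>UNIV. A i j * B j k) = (if i = k then 1 else 0)"
    by (rule independent_linear_forms_matrix[OF assms]) (rule that)
  then show ?thesis
    by (rule koszul_exact_linear_change[OF koszul_exact_mvar])
qed

text \<open>Since d is at least 2, no \<open>f\<close> divides a nonzero linear form. Primality
  comes from unique factorization.\<close>

lemma hilbert_burch_linear_forms:
  fixes f1 f2 f3 l1 l2 l3 :: "(3, 'k::field) mpoly"
  assumes "koszul_exact l1 l2 l3" and l: "homogeneous 1 l1" "homogeneous 1 l2" "homogeneous 1 l3"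
    and f: "homogeneous d f1" "homogeneous d f2" "homogeneous d f3" and "d \<ge> 2"
    and irred: "irreducible f1" "irreducible f2" "irreducible f3"
    and ndvd: "\<not> f1 dvd f2" "\<not> f1 dvd f3" "\<not> f2 dvd f3"
  shows "hilbert_burch l1 l2 l3 f1 f2 f3"
proof -
  interpret koszul_exact l1 l2 l3 by fact
  \<comment> \<open>If a nonunit g divides an irreducible f, the cofactor is a unit, so f also
    divides g. Hence three of the six non-divisibilities imply the others.\<close>
  have sym: "\<not> g dvd f" if "irreducible f" "irreducible g" "\<not> f dvd g" for f g :: "(3, 'k) mpoly"
  proof
    assume "g dvd f"
    then obtain h where h: "f = g * h" by (rule dvdE)
    have "h dvd 1"
      using that(1,2) h by (meson irreducibleD irreducible_not_unit)
    then show False using that(3) h by (metis dvd_mult_unit_iff' dvd_refl mult_unit_dvd_iff)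
  qed
  have "l1 \<noteq> 0" "l2 \<noteq> 0" "l3 \<noteq> 0"
    using nonzero by blast+
  then have "\<not> f1 dvd l2" "\<not> f2 dvd l3" "\<not> f3 dvd l1"
    using homogeneous_dvd_degree_le[OF f(1) l(2)] homogeneous_dvd_degree_le[OF f(2) l(3)]
      homogeneous_dvd_degree_le[OF f(3) l(1)] \<open>d \<ge> 2\<close> by auto
  then show ?thesis
    using irred ndvd sym by unfold_locales (auto intro: irreducible_imp_prime_elem_mpoly)
qed

section \<open>Membership in the base ideal and in its extension by
  \<open>f1 * f2 * f3\<close>\<close>

context hilbert_burch
begin

lemma base_ideal_iff: "x \<in> ideal_gen {g1, g2, g3} \<longleftrightarrow> (\<exists>a b c. x = a * g1 + b * g2 + c * g3)"
  by (rule ideal_gen_triple)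

lemma extended_ideal_iff:
  "x \<in> ideal_gen (ideal_gen {g1, g2, g3} \<union> {f1 * f2 * f3}) \<longleftrightarrow>
    (\<exists>a b c d. x = a * g1 + b * g2 + c * g3 + d * (f1 * f2 * f3))"
    (is "?l \<longleftrightarrow> ?r")
proof
  assume ?l
  then obtain d y where "x = d * (f1 * f2 * f3) + y" "y \<in> ideal_gen {g1, g2, g3}"
    unfolding ideal_gen_ideal_gen_insert ideal_gen_insert[of _ "f1 * f2 * f3"] by blast
  moreover then obtain a b c where "y = a * g1 + b * g2 + c * g3"
    using base_ideal_iff by blast
  ultimately show ?r by (metis add.commute)
next
  assume ?r
  then obtain a b c d where "x = d * (f1 * f2 * f3) + (a * g1 + b * g2 + c * g3)"
    by (metis add.commute)
  moreover have "a * g1 + b * g2 + c * g3 \<in> ideal_gen {g1, g2, g3}"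
    using base_ideal_iff by blast
  ultimately show ?l
    unfolding ideal_gen_ideal_gen_insert ideal_gen_insert[of _ "f1 * f2 * f3"] by blast
qed

text \<open>Multiplying \<open>f1 * f2 * f3\<close> by \<open>l1\<close>, \<open>l2\<close>,
  \<open>l3\<close> gives \<open>f3 * g1\<close>, \<open>f1 * g2\<close>, \<open>f2 * g3\<close>, so
  the new generator is pushed back into the base ideal.\<close>

lemma linear_mult_extended_ideal:
  assumes a: "a \<in> ideal_gen {l1, l2, l3}" and g: "g \<in> ideal_gen (ideal_gen {g1, g2, g3} \<union> {f1 * f2 * f3})"
  shows "a * g \<in> ideal_gen {g1, g2, g3}"
proof -
  obtain p q r where a: "a = p * l1 + q * l2 + r * l3"
    using a ideal_gen_triple by blast
  obtain u v w d where g: "g = u * g1 + v * g2 + w * g3 + d * (f1 * f2 * f3)"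
    using g extended_ideal_iff by blast
  have "a * g = (a * u + p * d * f3) * g1 + (a * v + q * d * f1) * g2 + (a * w + r * d * f2) * g3"
    unfolding g a by (simp add: algebra_simps)
  then show ?thesis using base_ideal_iff by blast
qed


lemma extended_ideal_saturated:
  assumes "\<And>a. a \<in> ideal_gen {l1, l2, l3} \<Longrightarrow>
    a * g \<in> ideal_gen (ideal_gen {g1, g2, g3} \<union> {f1 * f2 * f3})"
  shows "g \<in> ideal_gen (ideal_gen {g1, g2, g3} \<union> {f1 * f2 * f3})"
proof -
  have l: "l1 \<in> ideal_gen {l1, l2, l3}" "l2 \<in> ideal_gen {l1, l2, l3}" "l3 \<in> ideal_gen {l1, l2, l3}"
    by (simp_all add: ideal_gen_def ring_module.span_base)
  obtain a1 b1 c1 d1 where 1: "l1 * g = a1 * g1 + b1 * g2 + c1 * g3 + d1 * (f1 * f2 * f3)"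
    using assms[OF l(1)] extended_ideal_iff by blast
  obtain a2 b2 c2 d2 where 2: "l2 * g = a2 * g1 + b2 * g2 + c2 * g3 + d2 * (f1 * f2 * f3)"
    using assms[OF l(2)] extended_ideal_iff by blast
  obtain a3 b3 c3 d3 where 3: "l3 * g = a3 * g1 + b3 * g2 + c3 * g3 + d3 * (f1 * f2 * f3)"
    using assms[OF l(3)] extended_ideal_iff by blast
  show ?thesis using saturated_step[OF 1 2 3] extended_ideal_iff by blast
qed

end

lemma saturation_hilbert_burch:
  fixes f1 f2 f3 l1 l2 l3 :: "(3, 'k::field) mpoly"
  assumes "hilbert_burch l1 l2 l3 f1 f2 f3" and max: "max_ideal = ideal_gen {l1, l2, l3}"
  defines "I \<equiv> ideal_gen {l1 * f1 * f2, l2 * f2 * f3, l3 * f1 * f3}"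
  shows "saturation I = ideal_gen (I \<union> {f1 * f2 * f3})" and "saturation I \<noteq> I"
proof -
  interpret hilbert_burch l1 l2 l3 f1 f2 f3 by fact
  show eq: "saturation I = ideal_gen (I \<union> {f1 * f2 * f3})"
  proof (rule saturation_eqI)
    show "I \<subseteq> ideal_gen (I \<union> {f1 * f2 * f3})"
      by (auto simp: ideal_gen_def intro: ring_module.span_base)
    show "g \<in> ideal_gen (I \<union> {f1 * f2 * f3})"
      if "\<And>a. a \<in> max_ideal \<Longrightarrow> a * g \<in> ideal_gen (I \<union> {f1 * f2 * f3})" for g
      using that unfolding max I_def by (rule extended_ideal_saturated)
    show "a * g \<in> I" if "a \<in> max_ideal" "g \<in> ideal_gen (I \<union> {f1 * f2 * f3})" for a g
      using that unfolding max I_def by (rule linear_mult_extended_ideal)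
  qed
  have "f1 * f2 * f3 \<in> ideal_gen (I \<union> {f1 * f2 * f3})"
    by (simp add: ideal_gen_def ring_module.span_base)
  moreover have "f1 * f2 * f3 \<notin> I"
    using product_not_generated base_ideal_iff unfolding I_def by blast
  ultimately show "saturation I \<noteq> I" unfolding eq by blast
qed

text \<open>For d = s - 1 the shifts are 2s - 1, 3s - 1 and 3s; expressing them through d avoids
  truncated subtraction. Minimality holds because every nonzero matrix entry is, up to sign, a
  multiple of one of the linear forms.\<close>

lemma minimal_graded_resolution_hilbert_burch:
  fixes f1 f2 f3 l1 l2 l3 :: "(3, 'k::field) mpoly"
  assumes "hilbert_burch l1 l2 l3 f1 f2 f3" and max: "max_ideal = ideal_gen {l1, l2, l3}"
    and l: "homogeneous 1 l1" "homogeneous 1 l2" "homogeneous 1 l3"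
    and f: "homogeneous d f1" "homogeneous d f2" "homogeneous d f3"
    and a: "a = 2 * d + 1" and b: "b = 3 * d + 2" and c: "c = 3 * d + 3"
  shows "minimal_graded_resolution (ideal_gen {l1 * f1 * f2, l2 * f2 * f3, l3 * f1 * f3})
    (\<lambda>i::3. a) (\<lambda>j::3. b) (\<lambda>l::1. c)
    (vector [l1 * f1 * f2, l2 * f2 * f3, l3 * f1 * f3])
    (vector [vector [l2 * f3, - (l3 * f3), 0],
             vector [- (l1 * f1), 0, l3 * f1],
             vector [0, l1 * f2, - (l2 * f2)]])
    (vector [vector [l3], vector [l2], vector [l1]])"
    (is "minimal_graded_resolution _ _ _ _ ?g ?\<phi> ?\<psi>")
proof -
  interpret hilbert_burch l1 l2 l3 f1 f2 f3 by fact
  have g_sum: "(\<Sum>i\<in>UNIV. v $ i * ?g $ i) = v $ 1 * g1 + v $ 2 * g2 + v $ 3 * g3" for v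
    by (simp add: sum_3)
  have \<phi>: "?\<phi> *v w = vector [l2 * f3 * w $ 1 - l3 * f3 * w $ 2,
      - (l1 * f1) * w $ 1 + l3 * f1 * w $ 3, l1 * f2 * w $ 2 - l2 * f2 * w $ 3]" for w
    by (simp add: Finite_Cartesian_Product.vec_eq_iff forall_3 matrix_vector_mult_def sum_3)
  have \<psi>: "?\<psi> *v t = vector [l3 * t $ 1, l2 * t $ 1, l1 * t $ 1]" for t
    by (simp add: Finite_Cartesian_Product.vec_eq_iff forall_3 matrix_vector_mult_def)
  have hom: "homogeneous a g1" "homogeneous a g2" "homogeneous a g3"
    using homogeneous_mult[OF homogeneous_mult[OF l(1) f(1)] f(2)]
      homogeneous_mult[OF homogeneous_mult[OF l(2) f(2)] f(3)]
      homogeneous_mult[OF homogeneous_mult[OF l(3) f(1)] f(3)]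
    by (simp_all add: a mult_2)
  have lin: "homogeneous (1 + d) (l * f)" if "homogeneous 1 l" "homogeneous d f" for l f :: "(3, 'k) mpoly"
    using that by (rule homogeneous_mult)
  have deg: "1 + d + a = b" "1 + b = c" by (simp_all add: a b c)
  have graded: "graded_matrix (\<lambda>_. a) (\<lambda>_. b) ?\<phi>"
  proof -
    have "\<exists>e. e + a = b \<and> homogeneous e (l * f)" "\<exists>e. e + a = b \<and> homogeneous e (- (l * f))"
      if "homogeneous 1 l" "homogeneous d f" for l f :: "(3, 'k) mpoly"
      using deg(1) lin[OF that] homogeneous_uminus by blast+
    then show ?thesis
      unfolding graded_matrix_def forall_3 using l f by simp
  qed
  have graded': "graded_matrix (\<lambda>_. b) (\<lambda>_. c) ?\<psi>"
    unfolding graded_matrix_def forall_3 using deg(2) l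
    by (auto intro!: exI[of _ 1])
  have mem: "l1 \<in> max_ideal" "l2 \<in> max_ideal" "l3 \<in> max_ideal"
    unfolding max by (simp_all add: ideal_gen_def ring_module.span_base)
  have mult: "l * f \<in> max_ideal" "- (l * f) \<in> max_ideal" if "l \<in> max_ideal" for l f :: "(3, 'k) mpoly"
    using that ring_module.span_scale[of l _ f]
    by (simp_all add: max_ideal_def ideal_gen_def ring_module.span_neg mult.commute[of l])
  have zero: "0 \<in> (max_ideal :: (3, 'k) mpoly set)"
    by (simp add: max_ideal_def ideal_gen_def ring_module.span_zero)
  have "range (\<lambda>v. \<Sum>i\<in>UNIV. v $ i * ?g $ i) = ideal_gen {g1, g2, g3}"
  proof (intro equalityI subsetI)
    fix x assume "x \<in> ideal_gen {g1, g2, g3}"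
    then obtain u v w where "x = u * g1 + v * g2 + w * g3" using base_ideal_iff by blast
    then show "x \<in> range (\<lambda>v. \<Sum>i\<in>UNIV. v $ i * ?g $ i)"
      unfolding g_sum by (intro range_eqI[of _ _ "vector [u, v, w]"]) simp
  qed (use base_ideal_iff in \<open>auto simp: g_sum simp del: vector_3\<close>)
  moreover have "{v. (\<Sum>i\<in>UNIV. v $ i * ?g $ i) = 0} = range ((*v) ?\<phi>)"
  proof (intro equalityI subsetI)
    fix v assume "v \<in> {v. (\<Sum>i\<in>UNIV. v $ i * ?g $ i) = 0}"
    then obtain x y z where "v $ 1 = l2 * f3 * x - l3 * f3 * y" "v $ 2 = - (l1 * f1) * x + l3 * f1 * z"
      "v $ 3 = l1 * f2 * y - l2 * f2 * z"
      unfolding mem_Collect_eq g_sum first_syzygies by blast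
    then show "v \<in> range ((*v) ?\<phi>)"
      by (intro range_eqI[of _ _ "vector [x, y, z]"])
        (simp add: \<phi> Finite_Cartesian_Product.vec_eq_iff forall_3)
  next
    fix v assume "v \<in> range ((*v) ?\<phi>)"
    then obtain w where "v = ?\<phi> *v w" by blast
    then have "v $ 1 = l2 * f3 * w $ 1 - l3 * f3 * w $ 2" "v $ 2 = - (l1 * f1) * w $ 1 + l3 * f1 * w $ 3"
      "v $ 3 = l1 * f2 * w $ 2 - l2 * f2 * w $ 3"
      by (simp_all add: \<phi>)
    then show "v \<in> {v. (\<Sum>i\<in>UNIV. v $ i * ?g $ i) = 0}"
      unfolding mem_Collect_eq g_sum first_syzygies by blast
  qed
  moreover have "{w. ?\<phi> *v w = 0} = range ((*v) ?\<psi>)"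
  proof -
    have "?\<phi> *v w = 0 \<longleftrightarrow> (\<exists>t. w $ 1 = l3 * t \<and> w $ 2 = l2 * t \<and> w $ 3 = l1 * t)" for w
      unfolding second_syzygies[symmetric] \<phi>
      by (simp add: Finite_Cartesian_Product.vec_eq_iff forall_3)
    also have "\<dots> w \<longleftrightarrow> w \<in> range ((*v) ?\<psi>)" for w
    proof
      assume "\<exists>t. w $ 1 = l3 * t \<and> w $ 2 = l2 * t \<and> w $ 3 = l1 * t"
      then obtain t where "w $ 1 = l3 * t" "w $ 2 = l2 * t" "w $ 3 = l1 * t" by blast
      then show "w \<in> range ((*v) ?\<psi>)"
        by (intro range_eqI[of _ _ "vector [t]"])
          (simp add: \<psi> Finite_Cartesian_Product.vec_eq_iff forall_3)
    qed (auto simp: \<psi>)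
    finally show ?thesis by blast
  qed
  moreover have "inj ((*v) ?\<psi>)"
  proof (rule injI)
    fix t u :: "(3, 'k) mpoly ^ 1"
    assume "?\<psi> *v t = ?\<psi> *v u"
    \<comment> \<open>The third coordinate alone decides injectivity: it is multiplication by the
      nonzero \<open>l1\<close> in a domain.\<close>
    then have "(vector [l3 * t $ 1, l2 * t $ 1, l1 * t $ 1] :: (3, 'k) mpoly ^ 3) $ 3
        = (vector [l3 * u $ 1, l2 * u $ 1, l1 * u $ 1] :: (3, 'k) mpoly ^ 3) $ 3"
      unfolding \<psi> by simp
    then show "t = u" using nonzero by (simp add: Finite_Cartesian_Product.vec_eq_iff)
  qed
  moreover have "\<forall>i j. ?\<phi> $ i $ j \<in> max_ideal" "\<forall>j l. ?\<psi> $ j $ l \<in> max_ideal"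
    unfolding forall_3 using mem by (simp_all add: mult zero)
  ultimately show ?thesis
    unfolding minimal_graded_resolution_def forall_3 using hom graded graded'
    by (intro conjI) simp_all
qed

section \<open>The open set of point tuples and the proof of the proposition\<close>

lemma zariski_open_lists: "zariski_open r {ps. length ps = r}"
  unfolding zariski_open_def
\<comment> \<open>The constant 1 is multihomogeneous of multidegree 0 and vanishes nowhere, so it
  cuts out the whole space.\<close>
proof (intro exI[of _ "{1}"] conjI ballI)
  fix g :: "(nat \<times> 3, 'a) mpoly" assume "g \<in> {1}"
  then show "multihomogeneous r g"
    unfolding multihomogeneous_def by (intro exI[of _ "\<lambda>_. 0"]) simp
qed (simp add: mpoly_eval_def mpoly_lift_def)

theorem proposition4p12:
  fixes s :: nat and \<mu>s :: "nat list"
  defines "\<nu> \<equiv> replicate 3 (s - 1) @ map (\<lambda>m. 2 * m) \<mu>s"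
  assumes "s \<ge> 3" and "odd s"
    and "sub_homaloidal s (replicate 3 ((s - 1) div 2) @ \<mu>s)"
    and "proper_homaloidal_type TYPE('k::alg_closed_field) (2 * s - 1) \<nu>"
  shows "\<exists>U :: 'k proj_plane list set.
    zariski_open (length \<nu>) U \<and> U \<noteq> {} \<and>
    (\<forall>ps\<in>U. \<forall>F f1 f2 f3 l1 l2 l3.
       cremona_map_on_points (2 * s - 1) \<nu> ps F \<longrightarrow>
       principal_curve F (s - 1) f1 \<longrightarrow> principal_curve F (s - 1) f2 \<longrightarrow> principal_curve F (s - 1) f3 \<longrightarrow>
       \<not> f1 dvd f2 \<longrightarrow> \<not> f1 dvd f3 \<longrightarrow> \<not> f2 dvd f3 \<longrightarrow>
       homogeneous 1 l1 \<longrightarrow> homogeneous 1 l2 \<longrightarrow> homogeneous 1 l3 \<longrightarrow>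
       forms_independent (vector [l1, l2, l3]) \<longrightarrow>
       base_ideal F = ideal_gen {l1 * f1 * f2, l2 * f2 * f3, l3 * f1 * f3} \<longrightarrow>
       saturation (base_ideal F) \<noteq> base_ideal F \<and>
       minimal_graded_resolution (base_ideal F)
         (\<lambda>i::3. 2 * s - 1) (\<lambda>j::3. 3 * s - 1) (\<lambda>l::1. 3 * s)
         (vector [l1 * f1 * f2, l2 * f2 * f3, l3 * f1 * f3])
         (vector [vector [l2 * f3, - (l3 * f3), 0],
                  vector [- (l1 * f1), 0, l3 * f1],
                  vector [0, l1 * f2, - (l2 * f2)]])
         (vector [vector [l3], vector [l2], vector [l1]]) \<and>
       saturation (base_ideal F) = ideal_gen (base_ideal F \<union> {f1 * f2 * f3}))"
proof (intro exI conjI ballI allI impI)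
  show "zariski_open (length \<nu>) {ps :: 'k proj_plane list. length ps = length \<nu>}"
    by (rule zariski_open_lists)
  \<comment> \<open>A list repeating one arbitrary point has the required length; distinctness
    belongs to \<open>cremona_map_on_points\<close>, not to the open set.\<close>
  show "{ps :: 'k proj_plane list. length ps = length \<nu>} \<noteq> {}"
    using length_replicate[of "length \<nu>" undefined] by blast
next
  fix F and f1 f2 f3 l1 l2 l3 :: "(3, 'k) mpoly"
  assume "principal_curve F (s - 1) f1" "principal_curve F (s - 1) f2" "principal_curve F (s - 1) f3"
    and ndvd: "\<not> f1 dvd f2" "\<not> f1 dvd f3" "\<not> f2 dvd f3"
    and l: "homogeneous 1 l1" "homogeneous 1 l2" "homogeneous 1 l3"
    and indep: "forms_independent (vector [l1, l2, l3])"
    and I: "base_ideal F = ideal_gen {l1 * f1 * f2, l2 * f2 * f3, l3 * f1 * f3}"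
  then have f: "homogeneous (s - 1) f1" "homogeneous (s - 1) f2" "homogeneous (s - 1) f3"
    and irred: "irreducible f1" "irreducible f2" "irreducible f3"
    by (auto simp: principal_curve_def)
  let ?L = "vector [l1, l2, l3] :: (3, 'k) mpoly ^ 3"
  have L: "homogeneous 1 (?L $ i)" for i
    using exhaust_3[of i] l by auto
  have "koszul_exact l1 l2 l3"
    using koszul_exact_linear_forms[OF L indep] by simp
  then have hb: "hilbert_burch l1 l2 l3 f1 f2 f3"
    \<comment> \<open>The bound s \<ge> 3 makes the degree s - 1 of the principal curves at least
      2.\<close>
    using l f irred ndvd \<open>s \<ge> 3\<close>
    by (intro hilbert_burch_linear_forms[where d = "s - 1"]) auto
  have "range (($) ?L) = {l1, l2, l3}"
    unfolding UNIV_3 by simp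
  then have max: "max_ideal = ideal_gen {l1, l2, l3}"
    using max_ideal_eq_ideal_gen_linear_forms[OF L indep] by simp
  show "saturation (base_ideal F) \<noteq> base_ideal F"
    "saturation (base_ideal F) = ideal_gen (base_ideal F \<union> {f1 * f2 * f3})"
    unfolding I using saturation_hilbert_burch[OF hb max] by blast+
  show "minimal_graded_resolution (base_ideal F)
         (\<lambda>i::3. 2 * s - 1) (\<lambda>j::3. 3 * s - 1) (\<lambda>l::1. 3 * s)
         (vector [l1 * f1 * f2, l2 * f2 * f3, l3 * f1 * f3])
         (vector [vector [l2 * f3, - (l3 * f3), 0],
                  vector [- (l1 * f1), 0, l3 * f1],
                  vector [0, l1 * f2, - (l2 * f2)]])
         (vector [vector [l3], vector [l2], vector [l1]])"
    unfolding I using \<open>s \<ge> 3\<close>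
    by (intro minimal_graded_resolution_hilbert_burch[OF hb max l f]) auto
qed

end
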